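(* Let $A$ be a unital semi-simple commutative Banach algebra, $U$ an automorphism of $A$ with induced homeomorphism $\varphi$, and $w \in A$. Let $T = wU$ and let $\check{T}$ be the associated weighted composition operator on $\check{A}$. Assume that $U^n \neq I$ for all $n \in \mathbb{N}$ and that $\sigma(\check{T}) \subseteq \mathbb{T}$. Assume additionally that $\partial A$ contains no $\varphi$-periodic points and that every point of $\partial A$ is a peak point for the algebra $\check{A}$. Then $\mathbb{T} \subseteq \sigma(T)$.
   Context: $A$ is a unital commutative semi-simple Banach algebra with maximal ideal space $\mathfrak{M}_A$ and Shilov boundary $\partial A$. For $f\in A$, $\check f$ is the restriction of the Gelfand transform $\hat f$ to $\partial A$; $\check A$ is the closure of $\{\check f : f\in A\}$ in $C(\partial A)$ with sup norm. The automorphism $U$ induces a homeomorphism $\varphi$ of $\mathfrak{M}_A$ by $\widehat{Uf}(m)=\hat f(\varphi(m))$, and $\varphi(\partial A)=\partial A$. $T=wU$ means $Tf=w\cdot Uf$; $\check T$ is the operator on $\check A$ given by $(\check Tg)(t)=\check w(t)g(\varphi(t))$, $t\in\partial A$. A point $t\in\partial A$ is $\varphi$-periodic if $\varphi^n(t)=t$ for some $n\in\mathbb{N}$. A point $t\in\partial A$ is a peak point for $\check A$ if there is $g\in\check A$ with $g(t)=1$ and $|g(s)|<1$ for all $s\in\partial A$, $s\neq t$. $\mathbb{T}$ is the unit circle. *)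

theory Defs
  imports "HOL-Analysis.Analysis"
begin

text \<open>A unital commutative complex Banach algebra is modelled as a type of class
  real_normed_algebra_1, comm_ring_1, banach together with a distinguished element j
  (playing the role of i times the unit) with j * j = -1, such that the induced complex
  scalar multiplication is norm-homogeneous.\<close>

definition cscale :: "'a::real_normed_algebra_1 \<Rightarrow> complex \<Rightarrow> 'a \<Rightarrow> 'a" where
  "cscale j c x = Re c *\<^sub>R x + Im c *\<^sub>R (j * x)"

definition complex_banach_alg :: "'a::{real_normed_algebra_1,comm_ring_1,banach} \<Rightarrow> bool" where
  "complex_banach_alg j \<longleftrightarrow> j * j = -1 \<and> (\<forall>c x. norm (cscale j c x) = cmod c * norm x)"

text \<open>Maximal ideal space: the characters (nonzero multiplicative complex-linear functionals),
  carrying the Gelfand (weak-star) topology, i.e. the subspace topology of the product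
  topology on 'a => complex. The Gelfand transform of f is evaluation m |-> m f.\<close>

definition characters :: "'a::{real_normed_algebra_1,comm_ring_1,banach} \<Rightarrow> ('a \<Rightarrow> complex) set" where
  "characters j = {m. m 1 = 1 \<and> (\<forall>x y. m (x + y) = m x + m y) \<and> (\<forall>x y. m (x * y) = m x * m y)
                      \<and> (\<forall>c x. m (cscale j c x) = c * m x)}"

text \<open>Semi-simple: the Jacobson radical (= kernel of the Gelfand transform) is zero.\<close>
definition semisimple :: "'a::{real_normed_algebra_1,comm_ring_1,banach} \<Rightarrow> bool" where
  "semisimple j \<longleftrightarrow> (\<forall>f. (\<forall>m\<in>characters j. m f = 0) \<longrightarrow> f = 0)"

definition algebra_automorphism :: "'a::{real_normed_algebra_1,comm_ring_1,banach} \<Rightarrow> ('a \<Rightarrow> 'a) \<Rightarrow> bool" where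
  "algebra_automorphism j U \<longleftrightarrow> bij U \<and> U 1 = 1 \<and> (\<forall>x y. U (x + y) = U x + U y)
      \<and> (\<forall>x y. U (x * y) = U x * U y) \<and> (\<forall>c x. U (cscale j c x) = cscale j c (U x))"

text \<open>The induced map on the maximal ideal space: (Uf)^(m) = f^(phi m), i.e. phi m = m o U.\<close>
definition induced_map :: "('a \<Rightarrow> 'a) \<Rightarrow> ('a \<Rightarrow> complex) \<Rightarrow> ('a \<Rightarrow> complex)" where
  "induced_map U m = m \<circ> U"

definition is_boundary :: "'a::{real_normed_algebra_1,comm_ring_1,banach} \<Rightarrow> ('a \<Rightarrow> complex) set \<Rightarrow> bool" where
  "is_boundary j B \<longleftrightarrow> B \<subseteq> characters j \<and>
     (\<forall>f. \<exists>m\<in>B. \<forall>m'\<in>characters j. cmod (m' f) \<le> cmod (m f))"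

definition shilov_boundary :: "'a::{real_normed_algebra_1,comm_ring_1,banach} \<Rightarrow> ('a \<Rightarrow> complex) set" where
  "shilov_boundary j = \<Inter> {B. closed B \<and> is_boundary j B}"

text \<open>The algebra A-check: sup-norm closure in C(dA) of the restrictions of Gelfand transforms
  to the Shilov boundary. Elements are represented as functions vanishing off dA.\<close>
definition check_algebra :: "'a::{real_normed_algebra_1,comm_ring_1,banach} \<Rightarrow> (('a \<Rightarrow> complex) \<Rightarrow> complex) set" where
  "check_algebra j = {g. (\<forall>t. t \<notin> shilov_boundary j \<longrightarrow> g t = 0) \<and>
      (\<forall>e>0. \<exists>f. \<forall>t\<in>shilov_boundary j. cmod (g t - t f) < e)}"

definition check_op :: "'a::{real_normed_algebra_1,comm_ring_1,banach} \<Rightarrow> ('a \<Rightarrow> 'a) \<Rightarrow> 'a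
     \<Rightarrow> (('a \<Rightarrow> complex) \<Rightarrow> complex) \<Rightarrow> (('a \<Rightarrow> complex) \<Rightarrow> complex)" where
  "check_op j U w g = (\<lambda>t. if t \<in> shilov_boundary j then t w * g (induced_map U t) else 0)"

definition alg_spectrum :: "'a::{real_normed_algebra_1,comm_ring_1,banach} \<Rightarrow> ('a \<Rightarrow> 'a) \<Rightarrow> complex set" where
  "alg_spectrum j T = {c. \<not> bij (\<lambda>x. T x - cscale j c x)}"

definition check_spectrum :: "'a::{real_normed_algebra_1,comm_ring_1,banach} \<Rightarrow> ('a \<Rightarrow> 'a) \<Rightarrow> 'a \<Rightarrow> complex set" where
  "check_spectrum j U w = {c. \<not> bij_betw (\<lambda>g t. check_op j U w g t - c * g t)
                                   (check_algebra j) (check_algebra j)}"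

definition periodic_point :: "('a \<Rightarrow> 'a) \<Rightarrow> ('a \<Rightarrow> complex) \<Rightarrow> bool" where
  "periodic_point U t \<longleftrightarrow> (\<exists>n\<ge>1. (induced_map U ^^ n) t = t)"

definition peak_point :: "'a::{real_normed_algebra_1,comm_ring_1,banach} \<Rightarrow> ('a \<Rightarrow> complex) \<Rightarrow> bool" where
  "peak_point j t \<longleftrightarrow> (\<exists>g\<in>check_algebra j. g t = 1 \<and>
      (\<forall>s\<in>shilov_boundary j. s \<noteq> t \<longrightarrow> cmod (g s) < 1))"

end

theory Submission
  imports Defs "HOL-Complex_Analysis.Conformal_Mappings" "HOL-Probability.Discrete_Topology"
begin

text \<open>
  On the Shilov boundary \<open>w\<close> has no zeros, and along some orbit \<open>(p\<^sub>n)\<close>, \<open>n \<in> \<int>\<close>, the cocycle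
  \<open>w(p\<^sub>0) w(p\<^sub>1) \<cdots> w(p\<^sub>n\<^sub>-\<^sub>1)\<close> is dominated by \<open>r\<^sup>n\<close> in both directions, where \<open>r\<close> is the maximal
  growth rate. Let \<open>\<bar>c\<bar> = r\<close> and suppose that \<open>T - c\<close> is surjective, on \<open>A\<close> or on the boundary
  algebra. By the open mapping theorem every \<open>f\<close> can be divided by \<open>T - c\<close> again and again with
  geometric control of the norms. Read along the orbit and weighted by the normalised cocycle,
  \<open>T - c\<close> becomes the difference operator on sequences over \<open>\<int>\<close>; hence a Neumann series solves
  \<open>b(n+1) = z b(n) + a(n)\<close> with \<open>b(0)\<close> holomorphic in \<open>z\<close> near \<open>1\<close>, though bounded there only in
  terms of the norm of \<open>f\<close>. For \<open>\<bar>z\<bar> \<noteq> 1\<close> the bounded solution also satisfies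
  \<open>\<bar>b(0)\<bar> \<le> sup \<bar>a\<bar> / \<bar>\<bar>z\<bar> - 1\<bar>\<close>. Multiplying by a quadratic polynomial that vanishes where a small
  circle crosses \<open>\<bar>z\<bar> = 1\<close> (in logarithmic coordinates) and applying the maximum principle bounds
  the difference of \<open>b(0)\<close> across the unit circle in terms of \<open>sup \<bar>a\<bar>\<close> alone. But if \<open>f\<close> peaks at
  \<open>p\<^sub>0\<close> and is small on a long piece of the aperiodic orbit, then \<open>a\<close> is nearly a unit impulse, and
  \<open>b(0)\<close> jumps from about \<open>-1/z\<close> outside the unit circle to about \<open>0\<close> inside.

  So every \<open>c\<close> with \<open>\<bar>c\<bar> = r\<close> lies in both spectra. For the boundary algebra this forces \<open>r = 1\<close>.
\<close>

section \<open>Open mapping for closed linear relations\<close>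

lemma Baire_closed_cover:
  fixes S :: "'b::complete_space set" and F :: "nat \<Rightarrow> 'b set"
  assumes closed_nonempty: "closed S" "S \<noteq> {}" and cover: "S \<subseteq> (\<Union>n. F n)"
  obtains n x e where "x \<in> S" "e > 0" "ball x e \<inter> S \<subseteq> closure (F n)"
proof -
  have "\<exists>n. top_of_set S interior_of (S \<inter> closure (F n)) \<noteq> {}"
  proof (rule ccontr)
    assume "\<not> ?thesis"
    then have "top_of_set S interior_of \<Union>(range (\<lambda>n. S \<inter> closure (F n))) = {}"
      using closed_nonempty
      by (intro Baire_category_alt disjI1 completely_metrizable_space_closedin
            completely_metrizable_space_euclidean) (auto intro: closedin_closed_Int)
    moreover have "S \<subseteq> (\<Union>n. closure (F n))"
      by (rule order_trans[OF cover UN_mono]) (auto simp: closure_subset)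
    then have "\<Union>(range (\<lambda>n. S \<inter> closure (F n))) = S" by auto
    ultimately show False
      using closed_nonempty by (metis interior_of_topspace topspace_euclidean_subtopology)
  qed
  then obtain n x W where "openin (top_of_set S) W" "x \<in> W" "W \<subseteq> closure (F n)"
    unfolding interior_of_def by blast
  then show ?thesis
    using that by (metis openin_contains_ball openin_imp_subset subset_trans subsetD)
qed

lemma closed_relation_dense_ball:
  fixes G :: "('b::banach \<times> 'c::real_normed_vector) set"
  assumes subspace_G: "subspace G" and closed_domain: "closed (fst ` G)"
  obtains e r where "e > 0" "\<And>y d. y \<in> fst ` G \<Longrightarrow> norm y < e \<Longrightarrow> d > 0 \<Longrightarrow>
    \<exists>g\<in>G. norm (fst g - y) < d \<and> norm (snd g) \<le> r"
proof -
  let ?S = "fst ` G"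
  have subspace_domain: "subspace ?S"
    using subspace_G by (intro linear_subspace_image linear_fst)
  define F where "F n = fst ` {(z, u) \<in> G. norm u \<le> real n}" for n
  have "?S \<noteq> {}" using subspace_0[OF subspace_domain] by blast
  moreover have "?S \<subseteq> (\<Union>n. F n)"
    using real_arch_simple unfolding F_def by fastforce
  ultimately obtain n x e where centre: "x \<in> ?S" "e > 0"
    and ball_in_closure: "ball x e \<inter> ?S \<subseteq> closure (F n)"
    by (rule Baire_closed_cover[OF closed_domain]) (rule that)
  show ?thesis
  proof (rule that[of e "2 * real n"])
    fix y d assume y_in_ball: "y \<in> ?S" "norm y < e" and d_pos: "d > (0::real)"
    have "x + y \<in> closure (F n)" "x \<in> closure (F n)"
      using ball_in_closure centre y_in_ball subspace_add[OF subspace_domain]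
      by (auto simp: dist_norm subset_iff)
    then obtain p q where p_near: "p \<in> F n" "dist p (x + y) < d/2"
      and q_near: "q \<in> F n" "dist q x < d/2"
      using d_pos unfolding closure_approachable by (meson half_gt_zero)
    then obtain u v where bounded_lifts: "(p, u) \<in> G" "norm u \<le> n" "(q, v) \<in> G" "norm v \<le> n"
      by (auto simp: F_def)
    have "norm (p - q - y) < d"
      using p_near q_near norm_triangle_ineq4[of "p - (x + y)" "q - x"]
      by (simp add: dist_norm algebra_simps)
    moreover have "norm (u - v) \<le> 2 * real n"
      using bounded_lifts norm_triangle_ineq4[of u v] by simp
    moreover have "(p - q, u - v) \<in> G"
      using subspace_diff[OF subspace_G bounded_lifts(1) bounded_lifts(3)] by simp
    ultimately show "\<exists>g\<in>G. norm (fst g - y) < d \<and> norm (snd g) \<le> 2 * real n"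
      by (intro bexI[of _ "(p - q, u - v)"]) simp_all
  qed (rule centre)
qed

lemma norm_divideR_diff:
  fixes y z :: "'b::real_normed_vector"
  assumes "c > 0"
  shows "norm (z /\<^sub>R c - y) = norm (z - c *\<^sub>R y) / c"
  using assms norm_scaleR[of "inverse c" "z - c *\<^sub>R y"]
  by (simp add: scaleR_diff_right divide_inverse_commute)

lemma closed_relation_approximate_solution:
  fixes G :: "('b::banach \<times> 'c::real_normed_vector) set"
  assumes subspace_G: "subspace G" and closed_domain: "closed (fst ` G)"
  obtains K where "K > 0" "\<And>y d. y \<in> fst ` G \<Longrightarrow> d > 0 \<Longrightarrow>
    \<exists>g\<in>G. norm (fst g - y) < d \<and> norm (snd g) \<le> K * norm y"
proof -
  obtain r e where e_pos: "e > 0" and ball_approx: "\<And>y d. y \<in> fst ` G \<Longrightarrow> norm y < e \<Longrightarrow> d > 0 \<Longrightarrow>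
      \<exists>g\<in>G. norm (fst g - y) < d \<and> norm (snd g) \<le> r"
    using closed_relation_dense_ball[OF subspace_G closed_domain] by metis
  define K where "K = max 1 (2 * r / e)"
  show ?thesis
  proof (rule that[of K])
    show "K > 0" by (simp add: K_def)
    fix y d assume y_in_domain: "y \<in> fst ` G" and d_pos: "d > (0::real)"
    show "\<exists>g\<in>G. norm (fst g - y) < d \<and> norm (snd g) \<le> K * norm y"
    proof (cases "y = 0")
      case True
      then show ?thesis
        using d_pos subspace_0[OF subspace_G]
        by (intro bexI[of _ "(0, 0)"]) (simp_all add: zero_prod_def)
    next
      case False
      define c where "c = e / (2 * norm y)"
      have c_pos: "c > 0" using e_pos False by (simp add: c_def)
      have "c *\<^sub>R y \<in> fst ` G"
        using y_in_domain subspace_scale[OF linear_subspace_image[OF linear_fst subspace_G]]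
        by blast
      moreover have "norm (c *\<^sub>R y) < e" using e_pos False by (simp add: c_def)
      ultimately obtain z u where scaled_solution: "(z, u) \<in> G" "norm (z - c *\<^sub>R y) < c * d"
          "norm u \<le> r"
        using ball_approx[of "c *\<^sub>R y" "c * d"] c_pos d_pos by fastforce
      have "norm (z /\<^sub>R c - y) < d"
        using scaled_solution(2) c_pos
        by (simp add: norm_divideR_diff pos_divide_less_eq mult.commute)
      moreover have "norm (u /\<^sub>R c) \<le> r / c"
        using scaled_solution(3) c_pos by (simp add: divide_inverse_commute mult_left_mono)
      then have "norm (u /\<^sub>R c) \<le> (2 * r / e) * norm y"
        by (simp add: c_def field_simps)
      then have "norm (u /\<^sub>R c) \<le> K * norm y"
        unfolding K_def by (rule order_trans) (intro mult_right_mono max.cobounded2 norm_ge_zero)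
      ultimately show ?thesis
        using subspace_scale[OF subspace_G scaled_solution(1), of "inverse c"]
        by (intro bexI[of _ "(z /\<^sub>R c, u /\<^sub>R c)"]) simp_all
    qed
  qed
qed

lemma closed_relation_successive_approximation:
  fixes G :: "('b::real_normed_vector \<times> 'c::real_normed_vector) set"
  assumes subspace_G: "subspace G" and x_in_domain: "x \<in> fst ` G"
    and approximate_solution:
        "\<And>y d. y \<in> fst ` G \<Longrightarrow> d > 0 \<Longrightarrow> \<exists>g\<in>G. norm (fst g - y) < d \<and> norm (snd g) \<le> K * norm y"
    and K_pos: "K > 0"
  obtains g where "\<And>k. g k \<in> G" "(\<lambda>k. fst (g k)) sums x"
    "\<And>k. norm (snd (g k)) \<le> K * norm x * (1/2) ^ k"
proof (cases "x = 0")
  case True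
  then show ?thesis
    using that[of "\<lambda>_. 0"] subspace_0[OF subspace_G] by simp
next
  case False
  have subspace_domain: "subspace (fst ` G)"
    using subspace_G by (intro linear_subspace_image linear_fst)
  have tolerance_pos: "norm x / 2 ^ k > 0" for k using False by simp
  have "\<forall>k. \<forall>y\<in>fst ` G. \<exists>g\<in>G. norm (fst g - y) < norm x / 2 ^ Suc k \<and> norm (snd g) \<le> K * norm y"
    using approximate_solution[OF _ tolerance_pos] by blast
  then obtain h where h_approx: "\<And>k y. y \<in> fst ` G \<Longrightarrow> h k y \<in> G"
      "\<And>k y. y \<in> fst ` G \<Longrightarrow> norm (fst (h k y) - y) < norm x / 2 ^ Suc k"
      "\<And>k y. y \<in> fst ` G \<Longrightarrow> norm (snd (h k y)) \<le> K * norm y"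
    by metis
  define y where "y = rec_nat x (\<lambda>k y. y - fst (h k y))"
  define g where "g k = h k (y k)" for k
  have y_simps: "y 0 = x" "y (Suc k) = y k - fst (g k)" for k
    by (simp_all add: y_def g_def)
  have y_in_domain: "y k \<in> fst ` G" for k
    by (induction k)
       (auto simp: y_simps g_def x_in_domain
             intro!: subspace_diff[OF subspace_domain] imageI h_approx(1))
  have y_le: "norm (y k) \<le> norm x / 2 ^ k" for k
    using less_imp_le[OF h_approx(2)[OF y_in_domain]]
    by (cases k) (simp_all add: y_simps g_def norm_minus_commute)
  have "(\<lambda>k. norm x / 2 ^ k) \<longlonglongrightarrow> 0"
    using tendsto_mult_right_zero[OF LIMSEQ_power_zero[of "1/2::real"], of "norm x"]
    by (simp add: power_one_over)
  then have "y \<longlonglongrightarrow> 0"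
    by (rule Lim_null_comparison[rotated]) (use y_le in auto)
  from telescope_sums'[OF this] have "(\<lambda>k. fst (g k)) sums x"
    by (simp add: y_simps)
  moreover have "norm (snd (g k)) \<le> K * norm x * (1/2) ^ k" for k
    using h_approx(3)[OF y_in_domain, of k k] mult_left_mono[OF y_le[of k] less_imp_le[OF K_pos]]
    by (simp add: g_def power_one_over)
  ultimately show ?thesis
    using that[of g] h_approx(1)[OF y_in_domain] by (simp add: g_def)
qed

theorem open_mapping_closed_relation:
  fixes G :: "('b::banach \<times> 'c::banach) set"
  assumes closed_subspace: "subspace G" "closed G" and closed_domain: "closed (fst ` G)"
  obtains M where "M > 0" "\<And>x. x \<in> fst ` G \<Longrightarrow> \<exists>u. (x, u) \<in> G \<and> norm u \<le> M * norm x"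
proof -
  obtain K where K_pos: "K > 0" and approximate_solution: "\<And>y d. y \<in> fst ` G \<Longrightarrow> d > 0 \<Longrightarrow>
      \<exists>g\<in>G. norm (fst g - y) < d \<and> norm (snd g) \<le> K * norm y"
    using closed_relation_approximate_solution[OF closed_subspace(1) closed_domain] by metis
  have "\<exists>u. (x, u) \<in> G \<and> norm u \<le> 2 * K * norm x" if x_in_domain: "x \<in> fst ` G" for x
  proof -
    obtain g where g_series: "\<And>k. g k \<in> G" "(\<lambda>k. fst (g k)) sums x"
        "\<And>k. norm (snd (g k)) \<le> K * norm x * (1/2) ^ k"
      using closed_relation_successive_approximation[OF closed_subspace(1) x_in_domain
          approximate_solution K_pos]
      by metis
    have geometric_sums_K: "(\<lambda>k. K * norm x * (1/2::real) ^ k) sums (K * norm x * 2)"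
      using sums_mult[OF geometric_sums[of "1/2::real"]] by simp
    have summable_norm_snd: "summable (\<lambda>k. norm (snd (g k)))"
      by (rule summable_comparison_test[OF _ sums_summable[OF geometric_sums_K]])
         (use g_series(3) in auto)
    have limit: "(\<lambda>k. (\<Sum>i<k. fst (g i), \<Sum>i<k. snd (g i))) \<longlonglongrightarrow> (x, \<Sum>i. snd (g i))"
      using g_series(2) summable_LIMSEQ[OF summable_norm_cancel[OF summable_norm_snd]]
      unfolding sums_def
      by (rule tendsto_Pair)
    have "(\<Sum>i<k. fst (g i), \<Sum>i<k. snd (g i)) \<in> G" for k
      using subspace_sum[OF closed_subspace(1), of "{..<k}" g] g_series(1) by (simp flip: sum_prod)
    from closed_sequentially[OF closed_subspace(2) this limit] have "(x, \<Sum>i. snd (g i)) \<in> G" .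
    moreover have "norm (\<Sum>i. snd (g i)) \<le> (\<Sum>k. K * norm x * (1/2::real) ^ k)"
      by (rule order_trans[OF summable_norm[OF summable_norm_snd]
            suminf_le[OF g_series(3) summable_norm_snd sums_summable[OF geometric_sums_K]]])
    then have "norm (\<Sum>i. snd (g i)) \<le> 2 * K * norm x"
      using sums_unique[OF geometric_sums_K] by simp
    ultimately show ?thesis by blast
  qed
  then show ?thesis using that[of "2 * K"] K_pos by simp
qed

section \<open>Bounded responses of two-sided recurrences\<close>

definition bounded_response :: "complex \<Rightarrow> (int \<Rightarrow> complex) \<Rightarrow> (int \<Rightarrow> complex) \<Rightarrow> bool" where
  "bounded_response z a b \<longleftrightarrow> bounded (range b) \<and> (\<forall>n. b (n + 1) = z * b n + a n)"

lemma bounded_response_step: "bounded_response z a b \<Longrightarrow> b (n + 1) = z * b n + a n"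
  by (simp add: bounded_response_def)

lemma bounded_response_reverse:
  assumes "bounded_response z a b" "z \<noteq> 0"
  shows "bounded_response (1 / z) (\<lambda>n. - a (- 1 - n) / z) (\<lambda>n. b (- n))"
proof -
  have "bounded (range (\<lambda>n. b (- n)))"
    by (rule bounded_subset[of "range b"]) (use assms(1) in \<open>auto simp: bounded_response_def\<close>)
  moreover have "b (- (n + 1)) = 1 / z * b (- n) + - a (- 1 - n) / z" for n
    using bounded_response_step[OF assms(1), of "- 1 - n"] assms(2) by (simp add: field_simps)
  ultimately show ?thesis by (simp add: bounded_response_def)
qed

lemma bounded_response_norm_le_local:
  assumes response: "bounded_response z a b" and norm_z: "norm z < 1"
    and input_le: "\<And>i. i < N \<Longrightarrow> norm (a (n - 1 - int i)) \<le> K"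
  shows "norm (b n) - K / (1 - norm z) \<le> norm z ^ N * (norm (b (n - int N)) - K / (1 - norm z))"
  using input_le
proof (induction N)
  case (Suc N)
  let ?B = "K / (1 - norm z)"
  have fixpoint: "?B = K + norm z * ?B" using norm_z by (simp add: field_simps)
  have "b (n - int N) = z * b (n - int (Suc N)) + a (n - 1 - int N)"
    using bounded_response_step[OF response, of "n - int (Suc N)"] by (simp add: algebra_simps)
  then have "norm (b (n - int N)) \<le> norm z * norm (b (n - int (Suc N))) + K"
    using Suc.prems[of N] norm_triangle_ineq[of "z * b (n - int (Suc N))" "a (n - 1 - int N)"]
    by (simp add: norm_mult)
  then have "norm (b (n - int N)) - ?B \<le> norm z * (norm (b (n - int (Suc N))) - ?B)"
    using fixpoint by (simp only: right_diff_distrib)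
  then have
    "norm z ^ N * (norm (b (n - int N)) - ?B) \<le> norm z ^ Suc N * (norm (b (n - int (Suc N))) - ?B)"
    using mult_left_mono[of _ _ "norm z ^ N"] by (simp add: mult.assoc power_Suc2 del: power_Suc)
  with Suc show ?case by fastforce
qed simp

lemma bounded_response_norm_le_contracting:
  assumes response: "bounded_response z a b" and norm_z: "norm z < 1"
    and input_le: "\<And>n. norm (a n) \<le> K"
  shows "norm (b n) \<le> K / (1 - norm z)"
proof -
  obtain B where b_le_B: "\<And>n. norm (b n) \<le> B"
    using response unfolding bounded_response_def bounded_iff by auto
  let ?e = "K / (1 - norm z)"
  have "norm (b n) - ?e \<le> norm z ^ N * (B - ?e)" for N
    using bounded_response_norm_le_local[OF response norm_z, where N = N and n = n, OF input_le]
      b_le_B[of "n - int N"]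
      mult_left_mono[of "norm (b (n - int N)) - ?e" "B - ?e" "norm z ^ N"] by force
  moreover have "(\<lambda>N. norm z ^ N * (B - ?e)) \<longlonglongrightarrow> 0"
    using norm_z by (intro tendsto_mult_left_zero LIMSEQ_power_zero) simp
  ultimately have "norm (b n) - ?e \<le> 0"
    by (intro LIMSEQ_le_const) auto
  then show ?thesis by simp
qed

lemma bounded_response_norm_le:
  assumes response: "bounded_response z a b" and norm_z: "norm z \<noteq> 1"
    and input_le: "\<And>n. norm (a n) \<le> K"
  shows "norm (b n) \<le> K / \<bar>norm z - 1\<bar>"
proof (cases "norm z < 1")
  case True
  then show ?thesis using bounded_response_norm_le_contracting[OF response True input_le] by simp
next
  case False
  then have norm_z_gt_1: "norm z > 1" using norm_z by simp
  then have "z \<noteq> 0" by auto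
  have "norm (b (- (- n))) \<le> (K / norm z) / (1 - norm (1 / z))"
    by (rule bounded_response_norm_le_contracting[OF bounded_response_reverse[OF response \<open>z \<noteq> 0\<close>]])
       (use norm_z_gt_1 input_le in \<open>auto simp: norm_divide divide_right_mono divide_less_eq\<close>)
  also have "\<dots> = K / (norm z - 1)"
    using norm_z_gt_1 \<open>z \<noteq> 0\<close> by (simp add: norm_divide right_diff_distrib)
  finally show ?thesis using norm_z_gt_1 by simp
qed

definition near_impulse :: "nat \<Rightarrow> real \<Rightarrow> (int \<Rightarrow> complex) \<Rightarrow> bool" where
  "near_impulse N \<eta> a \<longleftrightarrow> norm (a 0 - 1) \<le> \<eta> \<and> (\<forall>n. norm (a n) \<le> 2) \<and>
     (\<forall>n. n \<noteq> 0 \<longrightarrow> \<bar>n\<bar> \<le> int N \<longrightarrow> norm (a n) \<le> \<eta>)"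

lemma near_impulse_mult:
  assumes "near_impulse N \<eta> a" "v 0 = 1" "\<And>n. norm (v n) \<le> 1"
  shows "near_impulse N \<eta> (\<lambda>n. v n * a n)"
proof -
  have "norm (v n * a n) \<le> norm (a n)" for n
    using assms(3)[of n] by (simp add: norm_mult mult_left_le_one_le)
  then show ?thesis
    using assms(1,2) unfolding near_impulse_def by (auto intro: order_trans)
qed

lemma impulse_response_contracting:
  assumes response: "bounded_response z a b" and norm_z: "norm z < 1"
    and input_le: "\<And>n. norm (a n) \<le> K" and input_small: "\<And>i. i < N \<Longrightarrow> norm (a (n - 1 - int i)) \<le> \<eta>"
    and eta_nonneg: "0 \<le> \<eta>"
  shows "norm (b n) \<le> (\<eta> + norm z ^ N * K) / (1 - norm z)"
proof -
  have "norm z ^ N * (norm (b (n - int N)) - \<eta> / (1 - norm z)) \<le> norm z ^ N * (K / (1 - norm z))"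
    using bounded_response_norm_le_contracting[OF response norm_z input_le, of "n - int N"]
      norm_z eta_nonneg
    by (intro mult_left_mono)
       (auto intro!: diff_le_eq[THEN iffD2] add_increasing2 divide_nonneg_nonneg)
  then have "norm (b n) \<le> \<eta> / (1 - norm z) + norm z ^ N * (K / (1 - norm z))"
    using bounded_response_norm_le_local[OF response norm_z, where N = N and n = n, OF input_small]
    by linarith
  then show ?thesis by (simp add: add_divide_distrib)
qed

lemma impulse_response_expanding:
  assumes response: "bounded_response z a b" and norm_z: "norm z > 1"
    and input_le: "\<And>n. norm (a n) \<le> K" and input_small: "\<And>i. i < N \<Longrightarrow> norm (a (n + int i)) \<le> \<eta>"
    and eta_nonneg: "0 \<le> \<eta>"
  shows "norm (b n) \<le> (\<eta> + (1 / norm z) ^ N * K) / (norm z - 1)"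
proof -
  have "z \<noteq> 0" using norm_z by auto
  have "norm (b (- (- n))) \<le> (\<eta> / norm z + norm (1 / z) ^ N * (K / norm z)) / (1 - norm (1 / z))"
    by (rule impulse_response_contracting[OF bounded_response_reverse[OF response \<open>z \<noteq> 0\<close>]])
       (use norm_z input_le input_small eta_nonneg
         in \<open>auto simp: norm_divide divide_right_mono divide_less_eq add.commute\<close>)
  also have "\<dots> = (\<eta> + (1 / norm z) ^ N * K) / norm z / (1 - 1 / norm z)"
    by (simp add: norm_divide add_divide_distrib)
  also have "\<dots> = (\<eta> + (1 / norm z) ^ N * K) / (norm z - 1)"
    using norm_z \<open>z \<noteq> 0\<close> by (simp add: right_diff_distrib)
  finally show ?thesis by simp
qed

lemma geometric_tail_small:
  fixes q K \<delta> :: real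
  assumes q_range: "0 \<le> q" "q < 1" and delta_pos: "0 < \<delta>"
  obtains N \<eta> where "0 < \<eta>" "\<eta> \<le> \<delta>" "(\<eta> + q ^ N * K) / (1 - q) \<le> \<delta>"
proof -
  define \<eta> where "\<eta> = \<delta> * (1 - q) / 2"
  have eta_range: "\<eta> > 0" "\<eta> \<le> \<delta>"
    using q_range delta_pos
    by (auto simp: \<eta>_def mult_le_cancel_left1 intro: order_trans[of _ "\<delta> * 1"])
  have "(\<lambda>N. q ^ N * K) \<longlonglongrightarrow> 0"
    using q_range by (intro tendsto_mult_left_zero LIMSEQ_power_zero) auto
  then have "\<forall>\<^sub>F N in sequentially. q ^ N * K < \<eta>"
    using eta_range(1) by (rule order_tendstoD)
  then obtain N where "q ^ N * K < \<eta>"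
    by (auto simp: eventually_sequentially)
  then have "(\<eta> + q ^ N * K) / (1 - q) \<le> \<delta>"
    using q_range by (simp add: \<eta>_def pos_divide_le_eq)
  then show ?thesis using that eta_range by blast
qed

lemma near_impulse_response_inside:
  assumes impulse: "near_impulse N \<eta> a" and eta_nonneg: "0 \<le> \<eta>"
    and response: "bounded_response z a b" and norm_z: "norm z < 1"
  shows "norm (b 0) \<le> (\<eta> + norm z ^ N * 2) / (1 - norm z)"
  by (rule impulse_response_contracting[OF response norm_z])
     (use impulse eta_nonneg in \<open>auto simp: near_impulse_def\<close>)

lemma near_impulse_response_outside:
  assumes impulse: "near_impulse N \<eta> a" and eta_nonneg: "0 \<le> \<eta>"
    and response: "bounded_response z a b" and norm_z: "norm z > 1"
  shows "norm (z * b 0) \<ge> 1 - \<eta> - (\<eta> + (1 / norm z) ^ N * 2) / (norm z - 1)"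
proof -
  have "norm (b 1) \<le> (\<eta> + (1 / norm z) ^ N * 2) / (norm z - 1)"
    by (rule impulse_response_expanding[OF response norm_z])
       (use impulse eta_nonneg in \<open>auto simp: near_impulse_def\<close>)
  moreover have "z * b 0 = b 1 - a 0"
    using bounded_response_step[OF response, of 0] by simp
  moreover have "norm (b 1 - a 0) \<ge> norm (a 0) - norm (b 1)"
    by (metis norm_minus_commute norm_triangle_ineq2)
  moreover have "norm (a 0) \<ge> 1 - \<eta>"
    using norm_triangle_ineq2[of 1 "1 - a 0"] impulse
    by (simp add: near_impulse_def norm_minus_commute)
  ultimately show ?thesis by simp
qed

lemma impulse_response_jump:
  assumes s_range: "0 < s" "s \<le> 1/4"
  obtains N \<eta> where "\<eta> > 0"
    "\<And>a b b'. near_impulse N \<eta> a \<Longrightarrow> bounded_response (exp (of_real s)) a b \<Longrightarrow>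
      bounded_response (exp (of_real (- s))) a b' \<Longrightarrow> norm (b 0 - b' 0) \<ge> 1/4"
proof -
  define q where "q = exp (- s)"
  have q_range: "3/4 \<le> q" "0 < q" "q < 1"
    using s_range exp_ge_add_one_self[of "- s"] by (auto simp: q_def)
  have norm_exp: "norm (exp (complex_of_real s)) = 1 / q" "norm (exp (complex_of_real (- s))) = q"
    unfolding norm_exp_eq_Re by (simp_all add: q_def exp_minus inverse_eq_divide)
  obtain N \<eta> where eta_range: "0 < \<eta>" "\<eta> \<le> 1/8" and tail_small: "(\<eta> + q ^ N * 2) / (1 - q) \<le> 1/8"
    by (rule geometric_tail_small[of q "1/8" 2]) (use q_range in auto)
  show ?thesis
  proof (rule that[OF eta_range(1)])
    fix a b b'
    assume impulse: "near_impulse N \<eta> a"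
      and response_outside: "bounded_response (exp (of_real s)) a b"
      and response_inside: "bounded_response (exp (of_real (- s))) a b'"
    have "norm (b' 0) \<le> (\<eta> + q ^ N * 2) / (1 - q)"
      using near_impulse_response_inside[OF impulse _ response_inside, unfolded norm_exp]
        q_range eta_range(1)
      by simp
    then have b'_small: "norm (b' 0) \<le> 1/8" using tail_small by linarith
    have "1 - q \<le> 1 / q - 1"
      using q_range mult_left_mono[of q 1 "1 - q"] by (simp add: field_simps)
    then have "(\<eta> + q ^ N * 2) / (1 / q - 1) \<le> (\<eta> + q ^ N * 2) / (1 - q)"
      using q_range eta_range(1) by (intro divide_left_mono) auto
    moreover have "norm (exp (of_real s) * b 0) \<ge> 1 - \<eta> - (\<eta> + q ^ N * 2) / (1 / q - 1)"
      using near_impulse_response_outside[OF impulse _ response_outside, unfolded norm_exp]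
        q_range eta_range(1)
      by simp
    ultimately have "norm (exp (of_real s) * b 0) \<ge> 3/4"
      using tail_small eta_range(2) by linarith
    then have "norm (b 0) \<ge> 3/4 * q"
      using q_range unfolding norm_mult norm_exp by (simp add: field_simps)
    then show "norm (b 0 - b' 0) \<ge> 1/4"
      using b'_small q_range(1) norm_triangle_ineq2[of "b 0" "b' 0"] by linarith
  qed
qed

section \<open>Iterated antidifferences\<close>

definition antidifference_growth :: "real \<Rightarrow> (int \<Rightarrow> complex) \<Rightarrow> bool" where
  "antidifference_growth M a \<longleftrightarrow> (\<exists>x C. x 0 = a \<and> (\<forall>k n. norm (x k n) \<le> C * M ^ k) \<and>
     (\<forall>k n. x (Suc k) (n + 1) - x (Suc k) n = x k n))"

lemma antidifference_holomorphic_response: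
  assumes growth: "antidifference_growth M a" and M_pos: "M > 0"
  obtains b where "\<And>\<mu>. norm \<mu> < 1 / M \<Longrightarrow> bounded_response (1 + \<mu>) a (b \<mu>)"
    "(\<lambda>\<mu>. b \<mu> 0) holomorphic_on ball 0 (1 / M)"
proof -
  obtain x C where x_0: "x 0 = a" and x_le: "\<And>k n. norm (x k n) \<le> C * M ^ k"
      and x_diff: "\<And>k n. x (Suc k) (n + 1) - x (Suc k) n = x k n"
    using growth unfolding antidifference_growth_def by metis
  define b where "b \<mu> n = (\<Sum>k. x (Suc k) n * \<mu> ^ k)" for \<mu> n
  have term_le: "norm (x (Suc k) n * \<mu> ^ k) \<le> (C * M) * (M * norm \<mu>) ^ k" for k n \<mu>
    using mult_right_mono[OF x_le[of "Suc k" n], of "norm \<mu> ^ k"]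
    by (simp add: norm_mult norm_power power_mult_distrib mult_ac)
  have summable_majorant: "summable (\<lambda>k. (C * M) * (M * norm \<mu>) ^ k)"
    if "norm \<mu> < 1 / M" for \<mu> :: complex
    using that M_pos by (intro summable_mult summable_geometric) (simp add: field_simps)
  have summable_response: "summable (\<lambda>k. x (Suc k) n * \<mu> ^ k)" if "norm \<mu> < 1 / M" for n \<mu>
    by (rule summable_comparison_test[OF _ summable_majorant[OF that]]) (use term_le in blast)
  show ?thesis
  proof (rule that)
    fix \<mu> :: complex assume norm_mu: "norm \<mu> < 1 / M"
    have "b \<mu> (n + 1) = (1 + \<mu>) * b \<mu> n + a n" for n
    proof -
      have summable_x: "summable (\<lambda>k. x k n * \<mu> ^ k)"
        using summable_response[OF norm_mu, of n] summable_powser_split_head[of "\<lambda>k. x k n" \<mu>]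
        by simp
      have "b \<mu> (n + 1) - b \<mu> n = (\<Sum>k. x k n * \<mu> ^ k)"
        unfolding b_def suminf_diff[OF summable_response[OF norm_mu] summable_response[OF norm_mu]]
        by (simp add: x_diff flip: left_diff_distrib)
      also have "\<dots> = a n + b \<mu> n * \<mu>"
        using powser_split_head(1)[OF summable_x] by (simp add: b_def x_0)
      finally show ?thesis by (simp add: algebra_simps)
    qed
    moreover have "norm (b \<mu> n) \<le> (\<Sum>k. (C * M) * (M * norm \<mu>) ^ k)" for n
      unfolding b_def by (rule norm_suminf_le) (use term_le summable_majorant[OF norm_mu] in auto)
    then have "bounded (range (b \<mu>))" by (auto simp: bounded_iff)
    ultimately show "bounded_response (1 + \<mu>) a (b \<mu>)"
      by (simp add: bounded_response_def)
  next
    show "(\<lambda>\<mu>. b \<mu> 0) holomorphic_on ball 0 (1 / M)"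
      unfolding b_def
      by (rule power_series_holomorphic[where a = "\<lambda>k. x (Suc k) 0"])
         (use summable_response in \<open>simp add: summable_sums\<close>)
  qed
qed

lemma norm_square_add_radius_square:
  assumes "norm \<zeta> = \<rho>"
  shows "norm (\<zeta>\<^sup>2 + of_real (\<rho>\<^sup>2)) = 2 * \<rho> * \<bar>Re \<zeta>\<bar>"
proof -
  \<comment> \<open>\<open>\<rho>\<^sup>2 = \<zeta> * cnj \<zeta>\<close>\<close>
  have "\<zeta>\<^sup>2 + of_real (\<rho>\<^sup>2) = \<zeta> * of_real (2 * Re \<zeta>)"
    using assms complex_norm_square[of \<zeta>] complex_add_cnj[of \<zeta>]
    by (simp add: power2_eq_square flip: distrib_left)
  then show ?thesis
    using assms by (simp add: norm_mult)
qed

lemma Schwarz_Lemma_sphere: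
  fixes f :: "complex \<Rightarrow> complex"
  assumes holomorphic_f: "f holomorphic_on ball 0 r" and f_0: "f 0 = 0"
    and rho_range: "0 < \<rho>" "\<rho> < r"
    and bound_on_sphere: "\<And>z. norm z = \<rho> \<Longrightarrow> norm (f z) \<le> B" and z_in_cball: "norm z \<le> \<rho>"
  shows "norm (f z) \<le> B * norm z / \<rho>"
proof -
  obtain h where f_eq_mult_h: "h holomorphic_on ball 0 r" "\<And>z. norm z < r \<Longrightarrow> f z = z * h z"
    using Schwarz3[OF holomorphic_f f_0] by metis
  have "norm (h z) \<le> B / \<rho>"
  proof (rule maximum_modulus_frontier[of h "cball 0 \<rho>"])
    show "h holomorphic_on interior (cball 0 \<rho>)"
      using f_eq_mult_h(1) by (rule holomorphic_on_subset) (use rho_range in auto)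
    show "continuous_on (closure (cball 0 \<rho>)) h"
      by (rule holomorphic_on_imp_continuous_on, rule holomorphic_on_subset[OF f_eq_mult_h(1)])
         (use rho_range in auto)
    fix \<xi> :: complex assume "\<xi> \<in> frontier (cball 0 \<rho>)"
    then have "norm \<xi> = \<rho>" by simp
    then show "norm (h \<xi>) \<le> B / \<rho>"
      using f_eq_mult_h(2)[of \<xi>] bound_on_sphere[of \<xi>] rho_range
      by (simp add: norm_mult field_simps)
  qed (use z_in_cball in auto)
  then have "norm z * norm (h z) \<le> norm z * (B / \<rho>)"
    by (intro mult_left_mono) auto
  then show ?thesis
    using f_eq_mult_h(2)[of z] z_in_cball rho_range by (simp add: norm_mult mult.commute)
qed

lemma holomorphic_difference_bound_across_axis:
  fixes G :: "complex \<Rightarrow> complex"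
  assumes holomorphic_G: "G holomorphic_on ball 0 r" and rho_range: "0 < \<rho>" "\<rho> < r"
    and bound_on_sphere: "\<And>\<zeta>. norm \<zeta> = \<rho> \<Longrightarrow> Re \<zeta> \<noteq> 0 \<Longrightarrow> norm (G \<zeta>) \<le> K / \<bar>Re \<zeta>\<bar>"
    and s_range: "0 < s" "s \<le> \<rho>"
  shows "norm (G (of_real s) - G (of_real (- s))) \<le> 4 * K * s / \<rho>\<^sup>2"
proof -
  define H where "H \<zeta> = (\<zeta>\<^sup>2 + of_real (\<rho>\<^sup>2)) * G \<zeta>" for \<zeta>
  have "K \<ge> 0"
    using order_trans[OF norm_ge_zero bound_on_sphere[of "of_real \<rho>"]] rho_range
    by (simp add: zero_le_divide_iff)
  have H_bound: "norm (H \<zeta>) \<le> 2 * \<rho> * K" if "norm \<zeta> = \<rho>" for \<zeta>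
  proof -
    have "norm (H \<zeta>) = 2 * \<rho> * (\<bar>Re \<zeta>\<bar> * norm (G \<zeta>))"
      by (simp only: H_def norm_mult norm_square_add_radius_square[OF that] mult.assoc)
    moreover have "\<bar>Re \<zeta>\<bar> * norm (G \<zeta>) \<le> K"
      using bound_on_sphere[OF that] \<open>K \<ge> 0\<close> by (cases "Re \<zeta> = 0") (auto simp: field_simps)
    ultimately show ?thesis using rho_range by (simp add: mult_left_mono)
  qed
  have holomorphic_G_reflected: "(\<lambda>\<zeta>. G (- \<zeta>)) holomorphic_on ball 0 r"
    by (rule holomorphic_on_compose_gen[OF _ holomorphic_G, unfolded o_def])
       (auto intro!: holomorphic_intros)
  have "norm (H (of_real s) - H (- of_real s)) \<le> (4 * \<rho> * K) * norm (complex_of_real s) / \<rho>"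
  proof (rule Schwarz_Lemma_sphere[where f = "\<lambda>\<zeta>. H \<zeta> - H (- \<zeta>)" and r = r])
    show "(\<lambda>\<zeta>. H \<zeta> - H (- \<zeta>)) holomorphic_on ball 0 r"
      unfolding H_def by (intro holomorphic_intros holomorphic_G holomorphic_G_reflected)
    show "norm (H z - H (- z)) \<le> 4 * \<rho> * K" if "norm z = \<rho>" for z
      using H_bound[of z] H_bound[of "- z"] norm_triangle_ineq4[of "H z" "H (- z)"] that by simp
  qed (use s_range rho_range in auto)
  moreover have
    "H (of_real s) - H (- of_real s) = of_real (s\<^sup>2 + \<rho>\<^sup>2) * (G (of_real s) - G (of_real (- s)))"
    by (simp add: H_def algebra_simps)
  then have
    "norm (H (of_real s) - H (- of_real s)) = (s\<^sup>2 + \<rho>\<^sup>2) * norm (G (of_real s) - G (of_real (- s)))"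
    by (simp only: norm_mult norm_of_real) simp
  moreover have "\<rho>\<^sup>2 * norm (G (of_real s) - G (of_real (- s)))
      \<le> (s\<^sup>2 + \<rho>\<^sup>2) * norm (G (of_real s) - G (of_real (- s)))"
    by (intro mult_right_mono) auto
  ultimately have "\<rho>\<^sup>2 * norm (G (of_real s) - G (of_real (- s))) \<le> 4 * K * s"
    using rho_range s_range by simp
  then show ?thesis using rho_range by (simp add: field_simps)
qed

lemma abs_exp_minus_one_ge:
  fixes x :: real
  assumes "\<bar>x\<bar> \<le> 1/2"
  shows "\<bar>x\<bar> / 2 \<le> \<bar>exp x - 1\<bar>"
proof (cases "x \<ge> 0")
  case True
  then show ?thesis using exp_ge_add_one_self[of x] by linarith
next
  case False
  have "(1 - x) * exp x \<le> 1"
    using exp_ge_add_one_self[of "- x"] by (simp add: exp_minus field_simps)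
  moreover have "(- x) * (1/2) \<le> (- x) * exp x"
    using False assms exp_ge_add_one_self[of x] by (intro mult_left_mono) linarith+
  ultimately have "(- x) / 2 \<le> 1 - exp x" by (simp add: algebra_simps)
  then show ?thesis using False by simp
qed

lemma bounded_response_exp_norm_le:
  assumes "bounded_response (exp \<zeta>) a b" "\<And>n. norm (a n) \<le> K"
    and zeta_range: "norm \<zeta> \<le> 1/2" "Re \<zeta> \<noteq> 0"
  shows "norm (b n) \<le> 2 * K / \<bar>Re \<zeta>\<bar>"
proof -
  have "K \<ge> 0" using order_trans[OF norm_ge_zero assms(2)] .
  have "\<bar>Re \<zeta>\<bar> / 2 \<le> \<bar>exp (Re \<zeta>) - 1\<bar>"
    using abs_Re_le_cmod[of \<zeta>] zeta_range(1) by (intro abs_exp_minus_one_ge) linarith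
  then have "K / \<bar>exp (Re \<zeta>) - 1\<bar> \<le> K / (\<bar>Re \<zeta>\<bar> / 2)"
    using zeta_range(2) \<open>K \<ge> 0\<close> by (intro divide_left_mono) auto
  moreover have "norm (b n) \<le> K / \<bar>exp (Re \<zeta>) - 1\<bar>"
    using bounded_response_norm_le[OF assms(1) _ assms(2)] zeta_range(2) by simp
  ultimately show ?thesis by (simp add: mult.commute)
qed

lemma exp_minus_one_small:
  fixes e :: real
  assumes e_pos: "e > 0"
  obtains d where "d > 0" "\<And>\<zeta>::complex. norm \<zeta> < d \<Longrightarrow> norm (exp \<zeta> - 1) < e"
proof -
  have "isCont (exp :: complex \<Rightarrow> complex) 0" by simp
  then show ?thesis
    using that e_pos unfolding continuous_at_eps_delta by (auto simp: dist_norm)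
qed

lemma antidifference_response_lipschitz:
  assumes M_pos: "M > 0"
  obtains \<rho> where "\<rho> > 0"
    "\<And>a K s. antidifference_growth M a \<Longrightarrow> (\<And>n. norm (a n) \<le> K) \<Longrightarrow> 0 < s \<Longrightarrow> s \<le> \<rho> \<Longrightarrow>
      \<exists>b b'. bounded_response (exp (of_real s)) a b \<and> bounded_response (exp (of_real (- s))) a b' \<and>
        norm (b 0 - b' 0) \<le> 8 * K * s / \<rho>\<^sup>2"
proof -
  have "1 / M > 0" using M_pos by simp
  then obtain d where exp_near_1: "d > 0" "\<And>\<zeta>::complex. norm \<zeta> < d \<Longrightarrow> norm (exp \<zeta> - 1) < 1 / M"
    by (rule exp_minus_one_small) (rule that)
  define \<rho> where "\<rho> = min d 1 / 2"
  have rho_range: "\<rho> > 0" "\<rho> < d" "\<rho> \<le> 1/2" using exp_near_1(1) by (auto simp: \<rho>_def)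
  show ?thesis
  proof (rule that[OF rho_range(1)])
    fix a K s
    assume input: "antidifference_growth M a" "\<And>n. norm (a n) \<le> K" and s_range: "0 < s" "s \<le> \<rho>"
    obtain b where b_response: "\<And>\<mu>. norm \<mu> < 1 / M \<Longrightarrow> bounded_response (1 + \<mu>) a (b \<mu>)"
        "(\<lambda>\<mu>. b \<mu> 0) holomorphic_on ball 0 (1 / M)"
      using antidifference_holomorphic_response[OF input(1) M_pos] by metis
    define B where "B \<zeta> = b (exp \<zeta> - 1)" for \<zeta>
    have B_response: "bounded_response (exp \<zeta>) a (B \<zeta>)" if "norm \<zeta> < d" for \<zeta>
      using b_response(1)[OF exp_near_1(2)[OF that]] by (simp add: B_def)
    have "(\<lambda>\<zeta>. B \<zeta> 0) holomorphic_on ball 0 d"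
      unfolding B_def
      by (rule holomorphic_on_compose_gen[OF _ b_response(2), unfolded o_def])
         (use exp_near_1(2) in \<open>auto intro!: holomorphic_intros\<close>)
    moreover have "norm (B \<zeta> 0) \<le> 2 * K / \<bar>Re \<zeta>\<bar>" if "norm \<zeta> = \<rho>" "Re \<zeta> \<noteq> 0" for \<zeta>
      using bounded_response_exp_norm_le[OF B_response input(2), of \<zeta>] that rho_range by simp
    ultimately have "norm (B (of_real s) 0 - B (of_real (- s)) 0) \<le> 4 * (2 * K) * s / \<rho>\<^sup>2"
      using holomorphic_difference_bound_across_axis[where G = "\<lambda>\<zeta>. B \<zeta> 0"] rho_range s_range
      by blast
    moreover have "norm (complex_of_real s) < d" "norm (complex_of_real (- s)) < d"
      using s_range rho_range by auto
    ultimately show "\<exists>b b'. bounded_response (exp (of_real s)) a b \<and>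
        bounded_response (exp (of_real (- s))) a b' \<and> norm (b 0 - b' 0) \<le> 8 * K * s / \<rho>\<^sup>2"
      using B_response by (intro exI[of _ "B (of_real s)"] exI[of _ "B (of_real (- s))"]) auto
  qed
qed

theorem antidifference_growth_not_near_impulse:
  assumes M_pos: "M > 0"
  obtains N \<eta> where "\<eta> > 0" "\<And>a. near_impulse N \<eta> a \<Longrightarrow> \<not> antidifference_growth M a"
proof -
  obtain \<rho> where rho_pos: "\<rho> > 0" and lipschitz:
    "\<And>a K s. antidifference_growth M a \<Longrightarrow> (\<And>n. norm (a n) \<le> K) \<Longrightarrow> 0 < s \<Longrightarrow> s \<le> \<rho> \<Longrightarrow>
      \<exists>b b'. bounded_response (exp (of_real s)) a b \<and> bounded_response (exp (of_real (- s))) a b' \<and>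
        norm (b 0 - b' 0) \<le> 8 * K * s / \<rho>\<^sup>2"
    using antidifference_response_lipschitz[OF M_pos] by metis
  define s where "s = Min {\<rho>, 1/4, \<rho>\<^sup>2 / 128}"
  have s_range: "0 < s" "s \<le> \<rho>" "s \<le> 1/4" "s \<le> \<rho>\<^sup>2 / 128"
    using rho_pos by (auto simp: s_def)
  obtain N \<eta> where eta_pos: "\<eta> > 0" and jump: "\<And>a b b'. near_impulse N \<eta> a \<Longrightarrow>
      bounded_response (exp (of_real s)) a b \<Longrightarrow> bounded_response (exp (of_real (- s))) a b' \<Longrightarrow>
      norm (b 0 - b' 0) \<ge> 1/4"
    using impulse_response_jump[OF s_range(1,3)] by metis
  have "\<not> antidifference_growth M a" if impulse: "near_impulse N \<eta> a" for a
  proof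
    assume "antidifference_growth M a"
    moreover have "norm (a n) \<le> 2" for n using impulse by (simp add: near_impulse_def)
    ultimately obtain b b' where "bounded_response (exp (of_real s)) a b"
        "bounded_response (exp (of_real (- s))) a b'" "norm (b 0 - b' 0) \<le> 8 * 2 * s / \<rho>\<^sup>2"
      using lipschitz[of a 2 s] s_range by blast
    then have "1/4 \<le> 16 * s / \<rho>\<^sup>2" using jump[OF impulse] by force
    moreover have "16 * s / \<rho>\<^sup>2 \<le> 1/8" using s_range(4) rho_pos by (simp add: field_simps)
    ultimately show False by simp
  qed
  then show ?thesis using that eta_pos by blast
qed

section \<open>Integer iterates and two-sided products\<close>

definition int_funpow :: "('a \<Rightarrow> 'a) \<Rightarrow> int \<Rightarrow> 'a \<Rightarrow> 'a" where
  "int_funpow f n = (if 0 \<le> n then f ^^ nat n else inv f ^^ nat (- n))"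

lemma int_funpow_of_nat [simp]: "int_funpow f (int n) = f ^^ n"
  by (simp add: int_funpow_def)

lemma int_funpow_0 [simp]: "int_funpow f 0 = id"
  by (simp add: int_funpow_def)

lemma int_funpow_add_one:
  assumes "bij f"
  shows "int_funpow f (n + 1) = f \<circ> int_funpow f n"
proof (cases "0 \<le> n")
  case True
  then show ?thesis by (simp add: int_funpow_def nat_add_distrib)
next
  case False
  then have "nat (- n) = Suc (nat (- (n + 1)))" by simp
  then have "int_funpow f n = inv f \<circ> inv f ^^ nat (- (n + 1))"
    using False by (simp only: int_funpow_def funpow.simps) simp
  moreover have "int_funpow f (n + 1) = inv f ^^ nat (- (n + 1))"
    using False by (cases "n = - 1") (simp_all add: int_funpow_def)
  ultimately show ?thesis
    using assms by (simp add: fun_eq_iff bij_is_surj surj_f_inv_f)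
qed

lemma int_funpow_add:
  assumes bij_f: "bij f"
  shows "int_funpow f (m + n) = int_funpow f m \<circ> int_funpow f n"
proof (induction m rule: int_induct[where k = 0])
  case (step1 m)
  then show ?case
    using int_funpow_add_one[OF bij_f, of "m + n"] int_funpow_add_one[OF bij_f, of m]
    by (simp add: comp_assoc add.commute add.left_commute)
next
  case (step2 m)
  have "f \<circ> int_funpow f (m - 1 + n) = f \<circ> (int_funpow f (m - 1) \<circ> int_funpow f n)"
    using step2 int_funpow_add_one[OF bij_f, of "m - 1 + n"]
      int_funpow_add_one[OF bij_f, of "m - 1"]
    by (simp add: fun_eq_iff)
  then show ?case
    using bij_f by (simp add: fun_eq_iff bij_is_inj inj_eq)
qed simp

definition int_prod :: "(int \<Rightarrow> 'b::field) \<Rightarrow> int \<Rightarrow> 'b" where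
  "int_prod f n = prod f {0..<n} / prod f {n..<0}"

lemma int_prod_0 [simp]: "int_prod f 0 = 1"
  by (simp add: int_prod_def)

lemma int_prod_add_one:
  assumes "f n \<noteq> 0"
  shows "int_prod f (n + 1) = int_prod f n * f n"
proof (cases "0 \<le> n")
  case True
  then have "{0..<n + 1} = insert n {0..<n}" by auto
  then show ?thesis using True by (simp add: int_prod_def mult.commute)
next
  case False
  then have "{n..<0} = insert n {n + 1..<0}" by auto
  then show ?thesis using False assms by (simp add: int_prod_def)
qed

lemma int_prod_nonzero: "(\<And>i. f i \<noteq> 0) \<Longrightarrow> int_prod f n \<noteq> 0"
  by (simp add: int_prod_def prod_zero_iff)

lemma int_prod_eqI:
  assumes F_recurrence: "F 0 = 1" "\<And>n. F (n + 1) = F n * f n" and f_nonzero: "\<And>n. f n \<noteq> 0"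
  shows "F n = int_prod f n"
proof (induction n rule: int_induct[where k = 0])
  case (step1 n)
  then show ?case by (simp add: F_recurrence int_prod_add_one f_nonzero)
next
  case (step2 n)
  then show ?case
    using F_recurrence(2)[of "n - 1"] int_prod_add_one[of f "n - 1"] f_nonzero by simp
qed (simp add: F_recurrence)

lemma int_prod_add:
  assumes "\<And>i. f i \<noteq> 0"
  shows "int_prod f (m + n) = int_prod f m * int_prod (\<lambda>i. f (m + i)) n"
proof -
  have "int_prod f (m + n) / int_prod f m = int_prod (\<lambda>i. f (m + i)) n"
    using int_prod_add_one[of f, OF assms] int_prod_nonzero[of f, OF assms] assms
    by (intro int_prod_eqI) (simp_all flip: add.assoc)
  then show ?thesis
    using int_prod_nonzero[of f, OF assms] by (simp add: field_simps)
qed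

lemma int_prod_divide_const:
  assumes "\<And>i. f i \<noteq> 0" "c \<noteq> 0"
  shows "int_prod (\<lambda>i. f i / c) n = int_prod f n / c powi n"
  using assms int_prod_add_one[of f, OF assms(1)]
  by (intro int_prod_eqI[symmetric]) (simp_all add: power_int_add_1 mult.commute)

section \<open>Maximal growth of cocycles\<close>

lemma linear_decay_attains_max:
  fixes q :: "int \<Rightarrow> real"
  assumes kappa_pos: "\<kappa> > 0" and decay: "\<And>m. q m \<le> C - \<kappa> * \<bar>of_int m\<bar>"
  obtains m0 where "\<And>m. q m \<le> q m0"
proof -
  let ?A = "{m. q m \<ge> q 0}"
  have "?A \<subseteq> {- \<lceil>(C - q 0) / \<kappa>\<rceil>..\<lceil>(C - q 0) / \<kappa>\<rceil>}"
  proof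
    fix m assume "m \<in> ?A"
    then have "\<kappa> * \<bar>of_int m\<bar> \<le> C - q 0" using decay[of m] by simp
    then have "\<bar>of_int m\<bar> \<le> (C - q 0) / \<kappa>" using kappa_pos by (simp add: field_simps)
    then show "m \<in> {- \<lceil>(C - q 0) / \<kappa>\<rceil>..\<lceil>(C - q 0) / \<kappa>\<rceil>}"
      by (simp add: abs_le_iff) linarith
  qed
  then have finite_superlevel: "finite ?A" by (rule finite_subset) simp
  then have "Max (q ` ?A) \<in> q ` ?A" by (intro Max_in) auto
  then obtain m0 where m0_max: "m0 \<in> ?A" "q m0 = Max (q ` ?A)" by force
  have "q m \<le> q m0" for m
  proof (cases "m \<in> ?A")
    case True
    then show ?thesis using m0_max(2) finite_superlevel by simp
  next
    case False
    then show ?thesis using m0_max(1) by simp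
  qed
  then show ?thesis by (rule that)
qed

locale compact_cocycle =
  fixes X :: "'x::topological_space set" and \<Phi> :: "int \<Rightarrow> 'x \<Rightarrow> 'x" and b :: "int \<Rightarrow> 'x \<Rightarrow> real"
  assumes compact_X: "compact X" and closed_X: "closed X" and X_nonempty: "X \<noteq> {}"
    and flow_mem: "x \<in> X \<Longrightarrow> \<Phi> n x \<in> X" and flow_0: "x \<in> X \<Longrightarrow> \<Phi> 0 x = x"
    and cocycle: "x \<in> X \<Longrightarrow> b (m + n) x = b m x + b n (\<Phi> m x)"
    and continuous_cocycle: "continuous_on X (b n)"
begin

lemma cocycle_0: "x \<in> X \<Longrightarrow> b 0 x = 0"
  using cocycle[of x 0 0] by (simp add: flow_0)

lemma cocycle_linear_bound: "\<exists>B. \<forall>n. \<forall>x\<in>X. \<bar>b (int n) x\<bar> \<le> B * real n"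
proof -
  have "compact (b 1 ` X)" by (intro compact_continuous_image continuous_cocycle compact_X)
  then obtain B where b_1_le: "\<And>x. x \<in> X \<Longrightarrow> \<bar>b 1 x\<bar> \<le> B"
    using compact_imp_bounded bounded_iff by (metis image_eqI real_norm_def)
  have "\<bar>b (int n) x\<bar> \<le> B * real n" if x_in_X: "x \<in> X" for n x
  proof (induction n)
    case (Suc n)
    have "b (int n + 1) x = b (int n) x + b 1 (\<Phi> (int n) x)"
      by (rule cocycle[OF x_in_X])
    then show ?case
      using Suc b_1_le[OF flow_mem[OF x_in_X, of "int n"]] by (simp add: add.commute algebra_simps)
  qed (simp add: cocycle_0 x_in_X)
  then show ?thesis by blast
qed

definition rates :: "real set" where
  "rates = {l. \<exists>C. \<forall>n. \<forall>x\<in>X. b (int n) x \<le> C + l * real n}"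

definition max_rate :: real where
  "max_rate = Inf rates"

lemma rates_nonempty: "rates \<noteq> {}"
proof -
  obtain B where "\<And>n x. x \<in> X \<Longrightarrow> \<bar>b (int n) x\<bar> \<le> B * real n"
    using cocycle_linear_bound by blast
  then have "B \<in> rates"
    unfolding rates_def by (auto intro!: exI[of _ 0] simp: abs_le_iff)
  then show ?thesis by blast
qed

lemma bdd_below_rates: "bdd_below rates"
proof -
  obtain B where linear_bound: "\<And>n x. x \<in> X \<Longrightarrow> \<bar>b (int n) x\<bar> \<le> B * real n"
    using cocycle_linear_bound by blast
  obtain x where x_in_X: "x \<in> X" using X_nonempty by blast
  have "- B \<le> l" if "l \<in> rates" for l
  proof (rule ccontr)
    assume "\<not> - B \<le> l"
    then have gap_pos: "- B - l > 0" by simp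
    obtain C where rate_bound: "\<And>n. b (int n) x \<le> C + l * real n"
      using \<open>l \<in> rates\<close> x_in_X by (auto simp: rates_def)
    obtain n :: nat where n_large: "C < real n * (- B - l)"
      using reals_Archimedean3[OF gap_pos] by blast
    have "- (B * real n) \<le> C + l * real n"
      using rate_bound[of n] linear_bound[OF x_in_X, of n] by linarith
    with n_large show False by (simp add: algebra_simps)
  qed
  then show ?thesis by (auto simp: bdd_below_def)
qed

lemma rate_above_max_rate:
  assumes "max_rate < l"
  obtains C where "0 \<le> C" "\<And>n x. x \<in> X \<Longrightarrow> b (int n) x \<le> C + l * real n"
proof -
  obtain l' C where l'_less: "l' < l" and rate_bound: "\<And>n x. x \<in> X \<Longrightarrow> b (int n) x \<le> C + l' * real n"
    using assms cInf_less_iff[OF rates_nonempty bdd_below_rates]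
    unfolding max_rate_def rates_def by blast
  have "b (int n) x \<le> \<bar>C\<bar> + l * real n" if "x \<in> X" for n x
    using rate_bound[OF that, of n] mult_right_mono[of l' l "real n"] l'_less by linarith
  then show ?thesis using that abs_ge_zero by blast
qed

lemma max_rate_le: "l \<in> rates \<Longrightarrow> max_rate \<le> l"
  unfolding max_rate_def by (rule cInf_lower[OF _ bdd_below_rates])

lemma rates_if_backward_excess:
  assumes finite_I: "finite I" and excess: "\<And>t. t \<in> X \<Longrightarrow> \<exists>m\<in>I. - l * real m < b (- int m) t"
  shows "l \<in> rates"
proof -
  obtain B where linear_bound: "\<And>n x. x \<in> X \<Longrightarrow> \<bar>b (int n) x\<bar> \<le> B * real n"
    using cocycle_linear_bound by blast
  obtain N where I_le_N: "\<And>m. m \<in> I \<Longrightarrow> m \<le> N"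
    using finite_I unfolding finite_nat_set_iff_bounded_le by blast
  define C where "C = \<bar>B - l\<bar> * real N"
  have "b (int n) y \<le> C + l * real n" if y_in_X: "y \<in> X" for n y
  proof (induction n rule: less_induct)
    case (less n)
    show ?case
    proof (cases "n \<le> N")
      case True
      have "(B - l) * real n \<le> \<bar>B - l\<bar> * real N"
        using True by (intro mult_mono) auto
      then show ?thesis using linear_bound[OF y_in_X, of n] by (simp add: C_def algebra_simps)
    next
      case False
      obtain m where m_excess: "m \<in> I" "- l * real m < b (- int m) (\<Phi> (int n) y)"
        using excess[OF flow_mem[OF y_in_X, of "int n"]] by blast
      then have "m \<noteq> 0" using cocycle_0[OF flow_mem[OF y_in_X, of "int n"]] by (intro notI) simp
      moreover have "m \<le> n" using I_le_N[OF m_excess(1)] False by simp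
      ultimately have "b (int (n - m)) y \<le> C + l * real (n - m)" by (intro less) simp
      moreover have "b (int (n - m)) y = b (int n) y + b (- int m) (\<Phi> (int n) y)"
        using cocycle[OF y_in_X, of "int n" "- int m"] \<open>m \<le> n\<close> by (simp add: of_nat_diff)
      ultimately show ?thesis using m_excess(2) \<open>m \<le> n\<close> by (simp add: of_nat_diff algebra_simps)
    qed
  qed
  then show ?thesis unfolding rates_def by blast
qed

lemma exists_backward_rate:
  assumes l_less: "l < max_rate"
  obtains t where "t \<in> X" "\<And>n. b (- int n) t \<le> - l * real n"
proof -
  define K where "K n = {t \<in> X. b (- int n) t \<le> - l * real n}" for n
  have "X \<inter> (\<Inter>n. K n) \<noteq> {}"
  proof (rule compact_imp_fip_image[OF compact_X])
    show "closed (K n)" for n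
      unfolding K_def
      by (intro continuous_on_closed_Collect_le closed_X continuous_cocycle continuous_on_const)
    fix I :: "nat set" assume "finite I"
    then have "\<not> (\<forall>t\<in>X. \<exists>m\<in>I. - l * real m < b (- int m) t)"
      using rates_if_backward_excess[of I l] max_rate_le[of l] l_less by auto
    then show "X \<inter> (\<Inter>n\<in>I. K n) \<noteq> {}" by (force simp: K_def not_less)
  qed
  then show ?thesis using that unfolding K_def by blast
qed

lemma exists_tilted_maximum:
  assumes kappa_pos: "\<kappa> > 0"
  obtains t where "t \<in> X" "\<And>n. b n t \<le> of_int n * max_rate + \<kappa> * \<bar>of_int n\<bar>"
proof -
  have nearby_rates: "max_rate - \<kappa>/2 < max_rate" "max_rate < max_rate + \<kappa>/2"
    using kappa_pos by simp_all
  obtain t where t_in_X: "t \<in> X" and backward: "\<And>n. b (- int n) t \<le> - (max_rate - \<kappa>/2) * real n"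
    using exists_backward_rate[OF nearby_rates(1)] by metis
  obtain C where C_nonneg: "C \<ge> 0" and forward: "\<And>n. b (int n) t \<le> C + (max_rate + \<kappa>/2) * real n"
    using rate_above_max_rate[OF nearby_rates(2)] t_in_X by metis
  \<comment> \<open>The penalty \<open>\<kappa> * \<bar>m\<bar>\<close> makes a maximum along the whole orbit exist; restarting the orbit
    there changes the penalty by at most \<open>\<kappa> * \<bar>n\<bar>\<close>.\<close>
  define q where "q m = b m t - of_int m * max_rate - \<kappa> * \<bar>of_int m\<bar>" for m
  have q_le: "q m \<le> C - \<kappa>/2 * \<bar>of_int m\<bar>" for m
  proof (cases m rule: int_cases2)
    case (nonneg n)
    then show ?thesis using forward[of n] by (simp add: q_def algebra_simps)
  next
    case (nonpos n)
    then show ?thesis using backward[of n] C_nonneg by (simp add: q_def algebra_simps)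
  qed
  obtain m0 where q_max: "\<And>m. q m \<le> q m0"
    using linear_decay_attains_max[of "\<kappa>/2" q C, OF _ q_le] kappa_pos by auto
  show ?thesis
  proof (rule that[of "\<Phi> m0 t"])
    show "\<Phi> m0 t \<in> X" by (rule flow_mem[OF t_in_X])
    fix n
    have "b n (\<Phi> m0 t) \<le> of_int n * max_rate + \<kappa> * (\<bar>of_int (m0 + n)\<bar> - \<bar>of_int m0\<bar>)"
      using q_max[of "m0 + n"] cocycle[OF t_in_X, of m0 n] by (simp add: q_def algebra_simps)
    also have "\<dots> \<le> of_int n * max_rate + \<kappa> * \<bar>of_int n\<bar>"
      using kappa_pos by (intro add_left_mono mult_left_mono) auto
    finally show "b n (\<Phi> m0 t) \<le> of_int n * max_rate + \<kappa> * \<bar>of_int n\<bar>" .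
  qed
qed

theorem exists_two_sided_maximum:
  obtains t where "t \<in> X" "\<And>n. b n t \<le> of_int n * max_rate"
proof -
  define K where
    "K = (\<lambda>(n, k). {t \<in> X. b n t \<le> of_int n * max_rate + 1 / real (Suc k) * \<bar>of_int n\<bar>})"
  have "X \<inter> (\<Inter>i. K i) \<noteq> {}"
  proof (rule compact_imp_fip_image[OF compact_X])
    show "closed (K i)" for i
      unfolding K_def case_prod_beta
      by (intro continuous_on_closed_Collect_le closed_X continuous_cocycle continuous_on_const)
    fix I :: "(int \<times> nat) set" assume "finite I"
    then obtain N where I_le_N: "\<And>i. i \<in> I \<Longrightarrow> snd i \<le> N"
      using finite_nat_set_iff_bounded_le[of "snd ` I"] by auto
    have "1 / real (Suc N) > 0" by simp
    then obtain t where t_tilted: "t \<in> X"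
        "\<And>n. b n t \<le> of_int n * max_rate + 1 / real (Suc N) * \<bar>of_int n\<bar>"
      by (rule exists_tilted_maximum) (rule that)
    have "t \<in> K i" if "i \<in> I" for i
    proof -
      have "1 / real (Suc N) * \<bar>of_int (fst i)\<bar> \<le> 1 / real (Suc (snd i)) * \<bar>of_int (fst i)\<bar>"
        using I_le_N[OF that] by (intro mult_right_mono divide_left_mono) auto
      then show ?thesis
        using t_tilted(1) t_tilted(2)[of "fst i"] by (auto simp: K_def case_prod_beta)
    qed
    then show "X \<inter> (\<Inter>i\<in>I. K i) \<noteq> {}" using t_tilted(1) by blast
  qed
  then obtain t where t_tilted: "t \<in> X"
      "\<And>n k. b n t \<le> of_int n * max_rate + 1 / real (Suc k) * \<bar>of_int n\<bar>"
    by (auto simp: K_def)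
  have "b n t \<le> of_int n * max_rate" for n
  proof (rule LIMSEQ_le_const)
    have "(\<lambda>k. of_int n * max_rate + 1 / real (Suc k) * \<bar>of_int n\<bar>)
        \<longlonglongrightarrow> of_int n * max_rate + 0 * \<bar>of_int n\<bar>"
      by (intro tendsto_intros lim_1_over_n[THEN LIMSEQ_Suc])
    then show "(\<lambda>k. of_int n * max_rate + 1 / real (Suc k) * \<bar>of_int n\<bar>) \<longlonglongrightarrow> of_int n * max_rate"
      by simp
  qed (use t_tilted(2) in blast)
  then show ?thesis using that t_tilted(1) by blast
qed

end

section \<open>Weighted composition operators on Banach function spaces\<close>

lemma weighted_composition_bounded_solution:
  fixes ev :: "'x \<Rightarrow> 'e::banach \<Rightarrow> complex"
  assumes closed_subspace: "subspace S" "closed S"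
    and bounded_linear_ev: "\<And>x. x \<in> X \<Longrightarrow> bounded_linear (ev x)"
    and phi_mem: "\<And>x. x \<in> X \<Longrightarrow> \<phi> x \<in> X"
    and solvable: "\<And>f. f \<in> S \<Longrightarrow> \<exists>g\<in>S. \<forall>x\<in>X. W x * ev (\<phi> x) g - c * ev x g = ev x f"
  obtains M R where "M > 0" "\<And>f. f \<in> S \<Longrightarrow> R f \<in> S" "\<And>f. f \<in> S \<Longrightarrow> norm (R f) \<le> M * norm f"
    "\<And>f x. f \<in> S \<Longrightarrow> x \<in> X \<Longrightarrow> W x * ev (\<phi> x) (R f) - c * ev x (R f) = ev x f"
proof -
  define G where "G = {(f, g). f \<in> S \<and> g \<in> S \<and> (\<forall>x\<in>X. W x * ev (\<phi> x) g - c * ev x g = ev x f)}"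
  have "subspace G"
    unfolding subspace_def G_def
    using closed_subspace(1) bounded_linear_ev bounded_linear_ev[OF phi_mem]
    by (auto simp: zero_prod_def subspace_0 subspace_add subspace_scale bounded_linear.linear
        linear_0 linear_add linear_scale algebra_simps simp flip: scaleR_diff_right)
  moreover have "G = S \<times> S \<inter> (\<Inter>x\<in>X. {p. W x * ev (\<phi> x) (snd p) - c * ev x (snd p) = ev x (fst p)})"
    by (auto simp: G_def)
  then have "closed G"
    by (simp only:)
       (intro closed_Int closed_Times closed_subspace(2) closed_INT ballI closed_Collect_eq
          continuous_on_diff continuous_on_mult continuous_on_const
          bounded_linear.continuous_on[OF bounded_linear_ev] phi_mem
          continuous_on_fst continuous_on_snd continuous_on_id; assumption)
  moreover have fst_G: "fst ` G = S"
    using solvable by (force simp: G_def)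
  then have "closed (fst ` G)" using closed_subspace(2) by simp
  ultimately obtain M where M_bound: "M > 0"
      "\<And>f. f \<in> fst ` G \<Longrightarrow> \<exists>g. (f, g) \<in> G \<and> norm g \<le> M * norm f"
    by (rule open_mapping_closed_relation) (rule that)
  then obtain R where R_solution: "\<And>f. f \<in> S \<Longrightarrow> (f, R f) \<in> G" "\<And>f. f \<in> S \<Longrightarrow> norm (R f) \<le> M * norm f"
    unfolding fst_G by metis
  show ?thesis
    by (rule that[OF M_bound(1), of R]) (use R_solution in \<open>auto simp: G_def\<close>)
qed

lemma funpow_norm_le:
  fixes R :: "'e::real_normed_vector \<Rightarrow> 'e"
  assumes R_bounded: "\<And>f. f \<in> S \<Longrightarrow> R f \<in> S" "\<And>f. f \<in> S \<Longrightarrow> norm (R f) \<le> M * norm f"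
    and M_nonneg: "M \<ge> 0" and f_in_S: "f \<in> S"
  shows "(R ^^ k) f \<in> S \<and> norm ((R ^^ k) f) \<le> M ^ k * norm f"
proof (induction k)
  case (Suc k)
  then have "norm (R ((R ^^ k) f)) \<le> M * (M ^ k * norm f)"
    using R_bounded(2)[of "(R ^^ k) f"] M_nonneg by (meson mult_left_mono order_trans)
  then show ?case using Suc R_bounded(1) by (simp add: mult.assoc)
qed (simp add: f_in_S)

lemma antidifference_growth_weighted_orbit:
  fixes ev :: "'x \<Rightarrow> 'e::real_normed_vector \<Rightarrow> complex"
  assumes R_bounded: "\<And>f. f \<in> S \<Longrightarrow> R f \<in> S" "\<And>f. f \<in> S \<Longrightarrow> norm (R f) \<le> M * norm f" and M_pos: "M > 0"
    and R_solves: "\<And>f x. f \<in> S \<Longrightarrow> x \<in> X \<Longrightarrow> W x * ev (\<phi> x) (R f) - c * ev x (R f) = ev x f"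
    and ev_le: "\<And>f x. f \<in> S \<Longrightarrow> x \<in> X \<Longrightarrow> norm (ev x f) \<le> norm f"
    and orbit: "\<And>n. p n \<in> X" "\<And>n. p (n + 1) = \<phi> (p n)"
    and weights: "\<And>n. c * v (n + 1) = v n * W (p n)" "\<And>n. norm (v n) \<le> 1"
    and f_in_S: "f \<in> S"
  shows "antidifference_growth (norm c * M) (\<lambda>n. v n * ev (p n) f)"
proof -
  define x where "x k n = c ^ k * v n * ev (p n) ((R ^^ k) f)" for k n
  have iterates: "(R ^^ k) f \<in> S \<and> norm ((R ^^ k) f) \<le> M ^ k * norm f" for k
    by (rule funpow_norm_le[OF R_bounded less_imp_le[OF M_pos] f_in_S])
  have "x 0 = (\<lambda>n. v n * ev (p n) f)"
    by (simp add: x_def fun_eq_iff)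
  moreover have "norm (x k n) \<le> norm f * (norm c * M) ^ k" for k n
  proof -
    have "norm (v n) * norm (ev (p n) ((R ^^ k) f)) \<le> 1 * (M ^ k * norm f)"
      using weights(2)[of n] ev_le[OF conjunct1[OF iterates[of k]] orbit(1)[of n]] iterates[of k]
      by (intro mult_mono) (auto intro: order_trans)
    then have
      "norm c ^ k * (norm (v n) * norm (ev (p n) ((R ^^ k) f))) \<le> norm c ^ k * (M ^ k * norm f)"
      by (intro mult_left_mono) auto
    then show ?thesis
      by (simp add: x_def norm_mult norm_power power_mult_distrib mult_ac)
  qed
  moreover have "x (Suc k) (n + 1) - x (Suc k) n = x k n" for k n
  proof -
    let ?g = "R ((R ^^ k) f)"
    have "x (Suc k) (n + 1) - x (Suc k) n
        = c ^ k * ((c * v (n + 1)) * ev (p (n + 1)) ?g - v n * (c * ev (p n) ?g))"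
      by (simp add: x_def algebra_simps)
    also have "\<dots> = c ^ k * v n * (W (p n) * ev (\<phi> (p n)) ?g - c * ev (p n) ?g)"
      unfolding weights(1) orbit(2) by (simp add: algebra_simps)
    also have "\<dots> = x k n"
      using R_solves[of "(R ^^ k) f" "p n"] iterates[of k] orbit(1) by (simp add: x_def)
    finally show ?thesis .
  qed
  ultimately show ?thesis
    unfolding antidifference_growth_def by blast
qed

theorem weighted_composition_not_surjective:
  fixes ev :: "'x \<Rightarrow> 'e::banach \<Rightarrow> complex"
  assumes closed_subspace: "subspace S" "closed S"
    and evaluation: "\<And>x. x \<in> X \<Longrightarrow> bounded_linear (ev x)"
        "\<And>f x. f \<in> S \<Longrightarrow> x \<in> X \<Longrightarrow> norm (ev x f) \<le> norm f"
    and phi_mem: "\<And>x. x \<in> X \<Longrightarrow> \<phi> x \<in> X" and c_nonzero: "c \<noteq> 0"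
    and orbit: "\<And>n. p n \<in> X" "\<And>n. p (n + 1) = \<phi> (p n)"
    and weight_dominated: "\<And>n. W (p n) \<noteq> 0" "\<And>n. norm (int_prod (\<lambda>i. W (p i) / c) n) \<le> 1"
    and exists_impulse: "\<And>N \<eta>. \<eta> > 0 \<Longrightarrow> \<exists>f\<in>S. near_impulse N \<eta> (\<lambda>n. ev (p n) f)"
  shows "\<exists>f\<in>S. \<forall>g\<in>S. \<exists>x\<in>X. W x * ev (\<phi> x) g - c * ev x g \<noteq> ev x f"
proof (rule ccontr)
  assume "\<not> ?thesis"
  then have "\<And>f. f \<in> S \<Longrightarrow> \<exists>g\<in>S. \<forall>x\<in>X. W x * ev (\<phi> x) g - c * ev x g = ev x f"
    by blast
  then obtain M R where M_pos: "M > 0"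
    and R_solution: "\<And>f. f \<in> S \<Longrightarrow> R f \<in> S" "\<And>f. f \<in> S \<Longrightarrow> norm (R f) \<le> M * norm f"
    "\<And>f x. f \<in> S \<Longrightarrow> x \<in> X \<Longrightarrow> W x * ev (\<phi> x) (R f) - c * ev x (R f) = ev x f"
    using weighted_composition_bounded_solution[where ev = ev and X = X and \<phi> = \<phi>,
        OF closed_subspace evaluation(1) phi_mem]
    by metis
  define v where "v = int_prod (\<lambda>i. W (p i) / c)"
  have weights: "v 0 = 1" "c * v (n + 1) = v n * W (p n)" "norm (v n) \<le> 1" for n
    using c_nonzero weight_dominated by (simp_all add: v_def int_prod_add_one)
  have "norm c * M > 0" using c_nonzero M_pos by simp
  then obtain N \<eta> where "\<eta> > 0"
    and not_impulse: "\<And>a. near_impulse N \<eta> a \<Longrightarrow> \<not> antidifference_growth (norm c * M) a"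
    by (rule antidifference_growth_not_near_impulse) (rule that)
  then obtain f where impulse_f: "f \<in> S" "near_impulse N \<eta> (\<lambda>n. ev (p n) f)"
    using exists_impulse by blast
  have "antidifference_growth (norm c * M) (\<lambda>n. v n * ev (p n) f)"
    by (rule antidifference_growth_weighted_orbit[of S R M X W ev \<phi>])
       (fact R_solution M_pos evaluation(2) orbit weights(2,3) impulse_f(1))+
  moreover have "near_impulse N \<eta> (\<lambda>n. v n * ev (p n) f)"
    by (rule near_impulse_mult[where v = v]) (fact impulse_f(2) weights(1,3))+
  ultimately show False using not_impulse by blast
qed

section \<open>Characters and the Shilov boundary\<close>

locale complex_banach_algebra =
  fixes j :: "'a::{real_normed_algebra_1,comm_ring_1,banach}"
  assumes complex_banach_alg: "complex_banach_alg j"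

context
  fixes j :: "'a::{real_normed_algebra_1,comm_ring_1,banach}" and m :: "'a \<Rightarrow> complex"
  assumes character: "m \<in> characters j"
begin

lemma character_1: "m 1 = 1"
  and character_add: "m (x + y) = m x + m y"
  and character_mult: "m (x * y) = m x * m y"
  and character_cscale: "m (cscale j c x) = c * m x"
  using character by (simp_all add: characters_def)

lemma character_power: "m (x ^ n) = m x ^ n"
  by (induction n) (simp_all add: character_1 character_mult)

lemma character_scaleR: "m (r *\<^sub>R x) = of_real r * m x"
  using character_cscale[of "of_real r" x] by (simp add: cscale_def)

lemma character_diff: "m (x - y) = m x - m y"
  using character_add[of x "(-1) *\<^sub>R y"] character_scaleR[of "-1" y] by simp

end

lemma continuous_on_eval [continuous_intros]: "continuous_on X (\<lambda>m. m f :: complex)"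
  by (rule continuous_on_subset[OF continuous_on_product_coordinates]) simp

lemma closed_characters: "closed (characters j)"
  unfolding characters_def
  by (intro closed_Collect_conj closed_Collect_all closed_Collect_eq continuous_intros)

context complex_banach_algebra
begin

lemma norm_cscale: "norm (cscale j c x) = cmod c * norm x"
  using complex_banach_alg by (simp add: complex_banach_alg_def)

lemma norm_character_le:
  assumes character: "m \<in> characters j"
  shows "cmod (m f) \<le> norm f"
proof (rule ccontr)
  assume "\<not> ?thesis"
  then have norm_f_less: "norm f < cmod (m f)" by simp
  then have "m f \<noteq> 0" by auto
  define x where "x = cscale j (1 / m f) f"
  have "norm x < 1"
    using norm_f_less \<open>m f \<noteq> 0\<close> by (simp add: x_def norm_cscale norm_divide)
  then have summable_powers: "summable (\<lambda>n. x ^ n)" by (rule complete_algebra_summable_geometric)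
  define y where "y = (\<Sum>n. x ^ n)"
  have "y = 1 + x * y"
    using suminf_split_head[OF summable_powers] suminf_mult[OF summable_powers, of x]
    by (simp add: y_def)
  moreover have "m x = 1"
    using \<open>m f \<noteq> 0\<close> by (simp add: x_def character_cscale[OF character])
  ultimately have "m y = 1 + m y"
    by (metis character_add character_mult character_1 character mult_1)
  then show False by simp
qed

lemma bounded_linear_character:
  assumes character: "m \<in> characters j"
  shows "bounded_linear m"
  by (rule bounded_linear_intro[where K = 1])
     (simp_all add: character_add[OF character] character_scaleR[OF character]
         scaleR_conv_of_real[where 'a = complex]
       norm_character_le[OF character])

lemma compact_characters: "compact (characters j)"
proof -
  have "compactin (product_topology (\<lambda>_. euclidean) UNIV)
      (PiE UNIV (\<lambda>f::'a. cball (0::complex) (norm f)))"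
    by (simp add: compactin_PiE)
  then have "compact (PiE UNIV (\<lambda>f::'a. cball (0::complex) (norm f)))"
    by (simp add: euclidean_product_topology)
  moreover have "characters j \<subseteq> PiE UNIV (\<lambda>f::'a. cball (0::complex) (norm f))"
    using norm_character_le by auto
  ultimately show ?thesis
    using closed_characters by (metis compact_Int_closed inf.absorb2)
qed

end

definition sublevel ::
  "'a::{real_normed_algebra_1,comm_ring_1,banach} \<Rightarrow> 'a set \<Rightarrow> ('a \<Rightarrow> complex) set" where
  "sublevel j F = {m \<in> characters j. \<forall>g\<in>F. cmod (m g) < 1}"

lemma sublevel_neighbourhood:
  assumes character: "m \<in> characters j" and open_V: "open V" "m \<in> V"
  obtains F where "finite F" "m \<in> sublevel j F" "sublevel j F \<subseteq> V"
proof -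
  have "openin (product_topology (\<lambda>_. euclidean) UNIV) V"
    using open_V(1) by (simp add: open_fun_def)
  then obtain W where W_box: "finite {f. W f \<noteq> UNIV}" "\<And>f. open (W f)" "m \<in> PiE UNIV W"
      "PiE UNIV W \<subseteq> V"
    using open_V(2) unfolding openin_product_topology_alt by force
  have "\<exists>d>0. ball (m f) d \<subseteq> W f" for f
    using W_box(2,3) open_contains_ball by (metis PiE_mem UNIV_I)
  then obtain d where d_radius: "\<And>f. d f > 0" "\<And>f. ball (m f) (d f) \<subseteq> W f" by metis
  define g where "g f = (1 / d f) *\<^sub>R (f - cscale j (m f) 1)" for f
  have cmod_g: "cmod (m' (g f)) = cmod (m' f - m f) / d f" if "m' \<in> characters j" for m' f
    using d_radius(1)[of f] that
    by (simp add: g_def character_scaleR character_diff character_cscale character_1 norm_mult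
        norm_divide)
  show ?thesis
  proof (rule that[of "g ` {f. W f \<noteq> UNIV}"])
    show "m \<in> sublevel j (g ` {f. W f \<noteq> UNIV})"
      using character by (simp add: sublevel_def cmod_g)
    have "m' f \<in> W f" if m'_in_sublevel: "m' \<in> sublevel j (g ` {f. W f \<noteq> UNIV})" for m' f
    proof (cases "W f = UNIV")
      case False
      then have "cmod (m' f - m f) / d f < 1"
        using m'_in_sublevel cmod_g[of m' f] by (auto simp: sublevel_def)
      then have "m' f \<in> ball (m f) (d f)"
        using d_radius(1)[of f] by (simp add: dist_norm norm_minus_commute)
      then show ?thesis using d_radius(2) by blast
    qed simp
    then show "sublevel j (g ` {f. W f \<noteq> UNIV}) \<subseteq> V"
      using W_box(4) by auto
  qed (use W_box(1) in simp)
qed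

lemma closed_shilov_boundary: "closed (shilov_boundary j)"
  unfolding shilov_boundary_def by (rule closed_Inter) auto

locale algebra_with_characters = complex_banach_algebra +
  assumes characters_nonempty: "characters j \<noteq> {}"
begin

lemma cmod_character_power_mult:
  assumes character: "m \<in> characters j"
  shows "cmod (m (f ^ N * g)) = cmod (m f) ^ N * cmod (m g)"
  by (simp add: character_mult[OF character] character_power[OF character] norm_mult norm_power)

lemma maximal_character:
  obtains m where "m \<in> characters j" "\<And>m'. m' \<in> characters j \<Longrightarrow> cmod (m' f) \<le> cmod (m f)"
  using continuous_attains_sup[OF compact_characters characters_nonempty, of "\<lambda>m. cmod (m f)"]
  by (metis continuous_on_eval continuous_on_norm)

lemma is_boundary_characters: "is_boundary j (characters j)"
  unfolding is_boundary_def using maximal_character by (metis order_refl)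

lemma not_boundary_peak_function:
  assumes B_not_boundary: "B \<subseteq> characters j" "\<not> is_boundary j B"
  obtains f m where "m \<in> characters j" "cmod (m f) = 1" "\<And>m'. m' \<in> characters j \<Longrightarrow> cmod (m' f) \<le> 1"
    "\<And>m'. m' \<in> B \<Longrightarrow> cmod (m' f) < 1"
proof (cases "B = {}")
  case True
  obtain m where "m \<in> characters j" using characters_nonempty by blast
  with True show ?thesis by (intro that[of m 1]) (simp_all add: character_1)
next
  case False
  obtain h where h_not_maximal_on_B: "\<And>m'. m' \<in> B \<Longrightarrow> \<exists>m\<in>characters j. cmod (m' h) < cmod (m h)"
    using B_not_boundary unfolding is_boundary_def by (fastforce simp: not_le)
  obtain m where m_maximal: "m \<in> characters j" "\<And>m'. m' \<in> characters j \<Longrightarrow> cmod (m' h) \<le> cmod (m h)"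
    by (rule maximal_character) (rule that)
  have less_on_B: "cmod (m' h) < cmod (m h)" if "m' \<in> B" for m'
    using h_not_maximal_on_B[OF that] m_maximal(2) by (meson order_less_le_trans)
  then have max_pos: "cmod (m h) > 0"
    using False norm_ge_zero by (metis all_not_in_conv order_le_less_trans)
  define f where "f = (1 / cmod (m h)) *\<^sub>R h"
  have "cmod (m' f) = cmod (m' h) / cmod (m h)" if "m' \<in> characters j" for m'
    using that by (simp add: f_def character_scaleR norm_mult norm_divide)
  then show ?thesis
    using m_maximal less_on_B max_pos B_not_boundary(1)
    by (intro that[of m f]) (auto simp: subset_iff)
qed

lemma uniform_power_decay:
  assumes compact_K: "compact K" "K \<subseteq> characters j" and f_less: "\<And>m. m \<in> K \<Longrightarrow> cmod (m f) < 1"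
    and finite_F: "finite F"
  obtains N where "\<And>m g. m \<in> K \<Longrightarrow> g \<in> F \<Longrightarrow> cmod (m (f ^ N * g)) < 1"
proof (cases "K = {}")
  case False
  obtain m0 where m0_maximal: "m0 \<in> K" "\<And>m. m \<in> K \<Longrightarrow> cmod (m f) \<le> cmod (m0 f)"
    using continuous_attains_sup[OF compact_K(1) False, of "\<lambda>m. cmod (m f)"]
    by (metis continuous_on_eval continuous_on_norm)
  have "\<forall>\<^sub>F N in sequentially. \<forall>g\<in>F. cmod (m0 f) ^ N * norm g < 1"
  proof (rule eventually_ball_finite[OF finite_F], rule ballI)
    fix g
    have "(\<lambda>N. cmod (m0 f) ^ N * norm g) \<longlonglongrightarrow> 0"
      using f_less[OF m0_maximal(1)] by (intro tendsto_mult_left_zero LIMSEQ_power_zero) simp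
    then show "\<forall>\<^sub>F N in sequentially. cmod (m0 f) ^ N * norm g < 1"
      by (rule order_tendstoD) simp
  qed
  then obtain N where N_large: "\<And>g. g \<in> F \<Longrightarrow> cmod (m0 f) ^ N * norm g < 1"
    by (auto simp: eventually_sequentially)
  show ?thesis
  proof (rule that)
    fix m g assume m_in_K: "m \<in> K" and g_in_F: "g \<in> F"
    then have character: "m \<in> characters j" using compact_K(2) by blast
    have "cmod (m (f ^ N * g)) = cmod (m f) ^ N * cmod (m g)"
      by (rule cmod_character_power_mult[OF character])
    also have "\<dots> \<le> cmod (m0 f) ^ N * norm g"
      using m0_maximal(2)[OF m_in_K] norm_character_le[OF character]
      by (intro mult_mono power_mono) auto
    finally show "cmod (m (f ^ N * g)) < 1" using N_large[OF g_in_F] by linarith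
  qed
qed simp

lemma closed_diff_sublevel:
  assumes finite_F: "finite F" and B_characters: "closed B" "B \<subseteq> characters j"
  shows "closed (B - sublevel j F)"
proof -
  have "B - sublevel j F = B \<inter> (\<Union>g\<in>F. {m. 1 \<le> cmod (m g)})"
    using B_characters(2) by (force simp: sublevel_def not_less)
  then show ?thesis
    by (simp only:)
       (intro B_characters(1) finite_F closed_Int closed_UN ballI closed_Collect_le
          continuous_intros)
qed

lemma is_boundary_diff_sublevel:
  assumes finite_F: "finite F" and boundary_C: "is_boundary j C" "C \<inter> sublevel j F = {}"
    and boundary_B: "closed B" "is_boundary j B"
  shows "is_boundary j (B - sublevel j F)"
proof (rule ccontr)
  have B_characters: "B \<subseteq> characters j" and C_characters: "C \<subseteq> characters j"
    using boundary_B(2) boundary_C(1) by (auto simp: is_boundary_def)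
  assume not_boundary: "\<not> is_boundary j (B - sublevel j F)"
  have "B - sublevel j F \<subseteq> characters j" using B_characters by blast
  from this not_boundary obtain f m where f_attains_1: "m \<in> characters j" "cmod (m f) = 1"
    and f_le: "\<And>m'. m' \<in> characters j \<Longrightarrow> cmod (m' f) \<le> 1"
    and f_less: "\<And>m'. m' \<in> B - sublevel j F \<Longrightarrow> cmod (m' f) < 1"
    by (rule not_boundary_peak_function) (rule that)
  have "compact (B - sublevel j F)"
    using closed_diff_sublevel[OF finite_F boundary_B(1) B_characters]
      compact_characters B_characters
    by (metis Diff_subset compact_Int_closed inf.absorb2 order_trans)
  then obtain N where small_off_sublevel:
      "\<And>m' g. m' \<in> B - sublevel j F \<Longrightarrow> g \<in> F \<Longrightarrow> cmod (m' (f ^ N * g)) < 1"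
    by (rule uniform_power_decay[of _ f F]) (use B_characters f_less finite_F in auto)
  have small_on_B: "cmod (m' (f ^ N * g)) < 1" if m'_in_B: "m' \<in> B" and g_in_F: "g \<in> F" for m' g
  proof (cases "m' \<in> sublevel j F")
    case True
    then have m'_character: "m' \<in> characters j" and "cmod (m' g) < 1"
      using g_in_F by (auto simp: sublevel_def)
    moreover have "cmod (m' (f ^ N * g)) \<le> 1 * cmod (m' g)"
      unfolding cmod_character_power_mult[OF m'_character]
      using power_le_one[OF _ f_le[OF m'_character], of N] by (intro mult_right_mono) auto
    ultimately show ?thesis by simp
  qed (use small_off_sublevel m'_in_B g_in_F in blast)
  obtain m2 where m2_in_C: "m2 \<in> C" "cmod (m f) \<le> cmod (m2 f)"
    using boundary_C(1) f_attains_1(1) unfolding is_boundary_def by blast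
  then have m2_character: "m2 \<in> characters j" and "cmod (m2 f) = 1"
    using C_characters f_le f_attains_1(2) by (auto intro: antisym)
  then have "cmod (m2 g) = cmod (m2 (f ^ N * g))" for g
    by (simp add: cmod_character_power_mult[OF m2_character])
  moreover have "cmod (m2 (f ^ N * g)) < 1" if "g \<in> F" for g
    using boundary_B(2) m2_character small_on_B[OF _ that]
    unfolding is_boundary_def by (meson order_le_less_trans)
  ultimately have "m2 \<in> sublevel j F" using m2_character by (simp add: sublevel_def)
  then show False using m2_in_C(1) boundary_C(2) by blast
qed

lemma is_boundary_diff_sublevels:
  assumes "finite D" and "\<And>m. m \<in> D \<Longrightarrow> finite (F m)"
    and "\<And>m. m \<in> D \<Longrightarrow> \<exists>C. is_boundary j C \<and> C \<inter> sublevel j (F m) = {}"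
  shows "closed (characters j - (\<Union>m\<in>D. sublevel j (F m))) \<and>
    is_boundary j (characters j - (\<Union>m\<in>D. sublevel j (F m)))"
  using assms
proof (induction D)
  case (insert m D)
  have "characters j - (\<Union>m\<in>insert m D. sublevel j (F m))
      = (characters j - (\<Union>m\<in>D. sublevel j (F m))) - sublevel j (F m)" by blast
  moreover obtain C where "is_boundary j C" "C \<inter> sublevel j (F m) = {}"
    using insert.prems(2) by blast
  ultimately show ?case
    using is_boundary_diff_sublevel[of "F m" C] closed_diff_sublevel[of "F m"] insert by auto
qed (simp add: closed_characters is_boundary_characters)

theorem shilov_boundary_nonempty: "shilov_boundary j \<noteq> {}"
proof
  assume empty: "shilov_boundary j = {}"
  have "\<exists>F. finite F \<and> m \<in> sublevel j F \<and> (\<exists>C. is_boundary j C \<and> C \<inter> sublevel j F = {})"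
    if character: "m \<in> characters j" for m
  proof -
    obtain C where boundary_C: "closed C" "is_boundary j C" "m \<notin> C"
      using empty unfolding shilov_boundary_def by blast
    then have "open (- C)" "m \<in> - C" by auto
    then obtain F where "finite F" "m \<in> sublevel j F" "sublevel j F \<subseteq> - C"
      by (rule sublevel_neighbourhood[OF character])
    then show ?thesis using boundary_C(2) by blast
  qed
  then obtain F where separating_sublevel: "\<And>m. m \<in> characters j \<Longrightarrow> finite (F m)"
      "\<And>m. m \<in> characters j \<Longrightarrow> m \<in> sublevel j (F m)"
     "\<And>m. m \<in> characters j \<Longrightarrow> \<exists>C. is_boundary j C \<and> C \<inter> sublevel j (F m) = {}"
    by metis
  define V where "V m = (\<Inter>g\<in>F m. {m'. cmod (m' g) < 1})" for m
  have sublevel_V: "sublevel j (F m) = characters j \<inter> V m" for m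
    by (auto simp: sublevel_def V_def)
  have "open (V m)" if "m \<in> characters j" for m
    unfolding V_def using separating_sublevel(1)[OF that]
    by (intro open_INT ballI open_Collect_less continuous_intros)
  moreover have "characters j \<subseteq> (\<Union>m\<in>characters j. V m)"
    using separating_sublevel(2) sublevel_V by blast
  ultimately obtain D where finite_subcover: "D \<subseteq> characters j" "finite D"
      "characters j \<subseteq> (\<Union>m\<in>D. V m)"
    by (rule compactE_image[OF compact_characters])
  then have "is_boundary j (characters j - (\<Union>m\<in>D. sublevel j (F m)))"
    using is_boundary_diff_sublevels[of D F] separating_sublevel by blast
  moreover have "characters j - (\<Union>m\<in>D. sublevel j (F m)) = {}"
    using finite_subcover(3) unfolding sublevel_V by blast
  ultimately show False by (simp add: is_boundary_def)
qed

lemma shilov_boundary_subset_characters: "shilov_boundary j \<subseteq> characters j"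
  using closed_characters is_boundary_characters unfolding shilov_boundary_def by blast

lemma shilov_boundary_character: "t \<in> shilov_boundary j \<Longrightarrow> t \<in> characters j"
  using shilov_boundary_subset_characters by blast

lemma compact_shilov_boundary: "compact (shilov_boundary j)"
  using compact_characters closed_shilov_boundary shilov_boundary_subset_characters
  by (metis compact_Int_closed inf.absorb2)

end

section \<open>Automorphisms and the Shilov boundary\<close>

lemma automorphism_id: "algebra_automorphism j id"
  by (simp add: algebra_automorphism_def)

lemma automorphism_comp:
  "algebra_automorphism j U \<Longrightarrow> algebra_automorphism j V \<Longrightarrow> algebra_automorphism j (U \<circ> V)"
  by (auto simp: algebra_automorphism_def intro: bij_comp)

lemma automorphism_inv:
  assumes "algebra_automorphism j U"
  shows "algebra_automorphism j (inv U)"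
proof -
  have U_hom: "bij U" "U 1 = 1" "\<And>x y. U (x + y) = U x + U y" "\<And>x y. U (x * y) = U x * U y"
     "\<And>c x. U (cscale j c x) = cscale j c (U x)"
    using assms by (auto simp: algebra_automorphism_def)
  have U_inv: "U (inv U x) = x" for x
    using U_hom(1) by (simp add: bij_is_surj surj_f_inv_f)
  have U_injective: "x = y" if "U x = U y" for x y
    using that U_hom(1) by (simp add: bij_is_inj inj_eq)
  show ?thesis
    unfolding algebra_automorphism_def
    by (intro conjI allI bij_imp_bij_inv U_hom(1); rule U_injective) (simp_all add: U_inv U_hom)
qed

lemma automorphism_funpow: "algebra_automorphism j U \<Longrightarrow> algebra_automorphism j (U ^^ n)"
  by (induction n) (simp_all add: automorphism_id automorphism_comp)

lemma automorphism_int_funpow: "algebra_automorphism j U \<Longrightarrow> algebra_automorphism j (int_funpow U n)"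
  by (simp add: int_funpow_def automorphism_funpow automorphism_inv)

lemma induced_map_character:
  "algebra_automorphism j U \<Longrightarrow> m \<in> characters j \<Longrightarrow> induced_map U m \<in> characters j"
  by (simp add: algebra_automorphism_def characters_def induced_map_def)

lemma continuous_on_induced_map: "continuous_on X (induced_map U :: ('a \<Rightarrow> complex) \<Rightarrow> _)"
  unfolding induced_map_def o_def
  by (intro continuous_on_coordinatewise_then_product continuous_on_eval)

lemma induced_map_inv:
  assumes "bij U"
  shows "induced_map (inv U) (induced_map U m) = m" "induced_map U (induced_map (inv U) m) = m"
  using assms by (simp_all add: induced_map_def fun_eq_iff bij_is_surj surj_f_inv_f bij_is_inj)

lemma is_boundary_vimage_induced_map:
  assumes automorphism: "algebra_automorphism j U" and boundary_B: "is_boundary j B"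
  shows "is_boundary j (induced_map U -` B)"
  unfolding is_boundary_def
proof (intro conjI allI subsetI)
  have bij_U: "bij U" using automorphism by (simp add: algebra_automorphism_def)
  show "m \<in> characters j" if "m \<in> induced_map U -` B" for m
    using induced_map_character[OF automorphism_inv[OF automorphism], of "induced_map U m"]
      that boundary_B
    by (auto simp: is_boundary_def induced_map_inv[OF bij_U])
  fix f
  obtain m where m_maximal: "m \<in> B"
      "\<And>m'. m' \<in> characters j \<Longrightarrow> cmod (m' (inv U f)) \<le> cmod (m (inv U f))"
    using boundary_B unfolding is_boundary_def by blast
  have "cmod (m' f) \<le> cmod (induced_map (inv U) m f)" if "m' \<in> characters j" for m'
    using m_maximal(2)[OF induced_map_character[OF automorphism that]] bij_U
    by (simp add: induced_map_def bij_is_surj surj_f_inv_f)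
  then show "\<exists>m\<in>induced_map U -` B. \<forall>m'\<in>characters j. cmod (m' f) \<le> cmod (m f)"
    using m_maximal(1)
    by (intro bexI[of _ "induced_map (inv U) m"]) (simp_all add: induced_map_inv[OF bij_U])
qed

lemma induced_map_shilov_boundary:
  assumes automorphism: "algebra_automorphism j U" and t_in_boundary: "t \<in> shilov_boundary j"
  shows "induced_map U t \<in> shilov_boundary j"
proof -
  have "induced_map U t \<in> B" if "closed B" "is_boundary j B" for B
    using is_boundary_vimage_induced_map[OF automorphism that(2)]
      closed_vimage[OF that(1) continuous_on_induced_map[of UNIV U]] t_in_boundary
    unfolding shilov_boundary_def by blast
  then show ?thesis unfolding shilov_boundary_def by blast
qed

section \<open>The algebra of boundary functions\<close>

text \<open>A member of the boundary algebra vanishes off the boundary, so it need not be continuous on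
  the whole function space; the discrete topology turns the bounded functions on any type into a
  Banach space type.\<close>

instance bcontfun :: (metric_space, banach) banach ..

definition bounded_fun_apply :: "('x discrete, 'b::metric_space) bcontfun \<Rightarrow> 'x \<Rightarrow> 'b" where
  "bounded_fun_apply F x = apply_bcontfun F (discrete x)"

lemma exists_bounded_fun:
  assumes "bounded (range g)"
  obtains F where "bounded_fun_apply F = g"
proof -
  have "bounded (range (\<lambda>d. g (of_discrete d)))"
    by (rule bounded_subset[OF assms]) auto
  then have "(\<lambda>d. g (of_discrete d)) \<in> bcontfun"
    by (auto simp: bcontfun_def continuous_on_open_invariant open_discrete)
  then show ?thesis
    by (intro that[of "Bcontfun (\<lambda>d. g (of_discrete d))"] ext)
       (simp add: bounded_fun_apply_def Bcontfun_inverse discrete_inverse)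
qed

lemma norm_bounded_fun_apply_le: "norm (bounded_fun_apply F x) \<le> norm F"
  unfolding bounded_fun_apply_def by (rule norm_bounded)

lemma bounded_fun_apply_simps [simp]:
  "bounded_fun_apply 0 x = 0"
  "bounded_fun_apply (F + G) x = bounded_fun_apply F x + bounded_fun_apply G x"
  "bounded_fun_apply (F - G) x = bounded_fun_apply F x - bounded_fun_apply G x"
  "bounded_fun_apply (r *\<^sub>R F) x = r *\<^sub>R bounded_fun_apply F x"
  by (simp_all add: bounded_fun_apply_def)

lemma bounded_linear_bounded_fun_apply: "bounded_linear (\<lambda>F. bounded_fun_apply F x)"
  by (rule bounded_linear_intro[where K = 1]) (simp_all add: norm_bounded_fun_apply_le)

lemma check_algebra_eq_0: "g \<in> check_algebra j \<Longrightarrow> t \<notin> shilov_boundary j \<Longrightarrow> g t = 0"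
  by (simp add: check_algebra_def)

lemma check_algebra_approx:
  assumes "g \<in> check_algebra j" "e > 0"
  obtains f where "\<And>t. t \<in> shilov_boundary j \<Longrightarrow> cmod (g t - t f) < e"
  using assms unfolding check_algebra_def by blast

lemma gelfand_transform_in_check_algebra:
  "(\<lambda>t. if t \<in> shilov_boundary j then t f else 0) \<in> check_algebra j"
  unfolding check_algebra_def by (auto intro!: exI[of _ f])

context algebra_with_characters
begin

lemma bounded_check_algebra:
  assumes g_in_algebra: "g \<in> check_algebra j"
  shows "bounded (range g)"
proof -
  obtain f where f_approx: "\<And>t. t \<in> shilov_boundary j \<Longrightarrow> cmod (g t - t f) < 1"
    using check_algebra_approx[OF g_in_algebra zero_less_one] by metis
  have "cmod (g t) \<le> 1 + norm f" for t
  proof (cases "t \<in> shilov_boundary j")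
    case True
    then show ?thesis
      using f_approx[OF True] norm_character_le[OF shilov_boundary_character[OF True], of f]
        norm_triangle_sub[of "g t" "t f"] by linarith
  next
    case False
    then show ?thesis using check_algebra_eq_0[OF g_in_algebra] by (simp add: add_nonneg_nonneg)
  qed
  then show ?thesis by (auto simp: bounded_iff)
qed

lemma check_algebra_add:
  assumes g_in_algebra: "g \<in> check_algebra j" and h_in_algebra: "h \<in> check_algebra j"
  shows "(\<lambda>t. g t + h t) \<in> check_algebra j"
proof -
  have "\<exists>f. \<forall>t\<in>shilov_boundary j. cmod (g t + h t - t f) < e" if "e > 0" for e
  proof -
    have half_pos: "e/2 > 0" using that by simp
    obtain f1 f2 where approximants: "\<And>t. t \<in> shilov_boundary j \<Longrightarrow> cmod (g t - t f1) < e/2"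
        "\<And>t. t \<in> shilov_boundary j \<Longrightarrow> cmod (h t - t f2) < e/2"
      using check_algebra_approx[OF g_in_algebra half_pos]
        check_algebra_approx[OF h_in_algebra half_pos]
      by metis
    have "cmod (g t + h t - t (f1 + f2)) < e" if t_in_boundary: "t \<in> shilov_boundary j" for t
      using norm_diff_triangle_ineq[of "g t" "h t" "t f1" "t f2"] approximants[OF t_in_boundary]
      by (simp add: character_add[OF shilov_boundary_character[OF t_in_boundary]])
    then show ?thesis by blast
  qed
  then show ?thesis using g_in_algebra h_in_algebra by (simp add: check_algebra_def)
qed

lemma check_algebra_scaleR:
  assumes g_in_algebra: "g \<in> check_algebra j"
  shows "(\<lambda>t. r *\<^sub>R g t) \<in> check_algebra j"
proof -
  have "\<exists>f. \<forall>t\<in>shilov_boundary j. cmod (r *\<^sub>R g t - t f) < e" if "e > 0" for e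
  proof -
    have "e / (\<bar>r\<bar> + 1) > 0" using that by (simp add: add_nonneg_pos)
    then obtain f where f_approx: "\<And>t. t \<in> shilov_boundary j \<Longrightarrow> cmod (g t - t f) < e / (\<bar>r\<bar> + 1)"
      using check_algebra_approx[OF g_in_algebra] by metis
    have "cmod (r *\<^sub>R g t - t (r *\<^sub>R f)) < e" if t_in_boundary: "t \<in> shilov_boundary j" for t
    proof -
      have "cmod (r *\<^sub>R g t - t (r *\<^sub>R f)) = \<bar>r\<bar> * cmod (g t - t f)"
        unfolding character_scaleR[OF shilov_boundary_character[OF t_in_boundary]]
        by (simp add: scaleR_conv_of_real norm_mult flip: right_diff_distrib)
      also have "\<dots> \<le> (\<bar>r\<bar> + 1) * cmod (g t - t f)" by (intro mult_right_mono) auto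
      also have "\<dots> < e"
        using f_approx[OF t_in_boundary]
        by (simp add: pos_less_divide_eq add_nonneg_pos mult.commute)
      finally show ?thesis .
    qed
    then show ?thesis by blast
  qed
  then show ?thesis using g_in_algebra by (simp add: check_algebra_def)
qed

definition bounded_check_algebra_funs :: "(('a \<Rightarrow> complex) discrete, complex) bcontfun set" where
  "bounded_check_algebra_funs = {F. bounded_fun_apply F \<in> check_algebra j}"

lemma subspace_bounded_check_algebra_funs: "subspace bounded_check_algebra_funs"
proof -
  have "(\<lambda>t. 0) \<in> check_algebra j"
    using check_algebra_scaleR[OF gelfand_transform_in_check_algebra, of 0] by simp
  then show ?thesis
    unfolding subspace_def bounded_check_algebra_funs_def
    using check_algebra_add check_algebra_scaleR
    by (simp add: bounded_fun_apply_simps[abs_def])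
qed

lemma closed_bounded_check_algebra_funs: "closed bounded_check_algebra_funs"
  unfolding closed_sequential_limits
proof (intro allI impI, elim conjE)
  fix F l assume F_converges: "\<forall>n. F n \<in> bounded_check_algebra_funs" "F \<longlonglongrightarrow> l"
  have uniformly_near: "\<exists>n. \<forall>t. cmod (bounded_fun_apply l t - bounded_fun_apply (F n) t) < e"
    if e_pos: "e > 0" for e
  proof -
    obtain n where "dist (F n) l < e"
      using F_converges(2) e_pos unfolding lim_sequentially by blast
    then have "cmod (bounded_fun_apply l t - bounded_fun_apply (F n) t) < e" for t
      using norm_bounded_fun_apply_le[of "l - F n" t] by (simp add: dist_norm norm_minus_commute)
    then show ?thesis by blast
  qed
  have F_in_algebra: "bounded_fun_apply (F n) \<in> check_algebra j" for n
    using F_converges(1) by (simp add: bounded_check_algebra_funs_def)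
  have "\<exists>f. \<forall>t\<in>shilov_boundary j. cmod (bounded_fun_apply l t - t f) < e" if "e > 0" for e
  proof -
    have e_pos: "e/2 > 0" using that by simp
    obtain n where n_near: "\<And>t. cmod (bounded_fun_apply l t - bounded_fun_apply (F n) t) < e/2"
      using uniformly_near[OF e_pos] by blast
    obtain f where f_approx:
        "\<And>t. t \<in> shilov_boundary j \<Longrightarrow> cmod (bounded_fun_apply (F n) t - t f) < e/2"
      using check_algebra_approx[OF F_in_algebra e_pos] by metis
    have "cmod (bounded_fun_apply l t - t f) < e" if "t \<in> shilov_boundary j" for t
      by (rule norm_diff_triangle_less[OF n_near f_approx[OF that], THEN order_less_le_trans]) simp
    then show ?thesis by blast
  qed
  moreover have "bounded_fun_apply l t = 0" if t_off_boundary: "t \<notin> shilov_boundary j" for t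
  proof (rule ccontr)
    assume "bounded_fun_apply l t \<noteq> 0"
    then have "cmod (bounded_fun_apply l t) > 0" by simp
    from uniformly_near[OF this] obtain n where
      "cmod (bounded_fun_apply l t - bounded_fun_apply (F n) t) < cmod (bounded_fun_apply l t)"
      by blast
    then show False using check_algebra_eq_0[OF F_in_algebra t_off_boundary] by simp
  qed
  ultimately show "l \<in> bounded_check_algebra_funs"
    by (simp add: bounded_check_algebra_funs_def check_algebra_def)
qed

lemma check_algebra_power_approx:
  assumes g_in_ball: "g \<in> check_algebra j" "\<And>t. t \<in> shilov_boundary j \<Longrightarrow> cmod (g t) \<le> 1"
    and e_pos: "e > 0"
  obtains f where "\<And>t. t \<in> shilov_boundary j \<Longrightarrow> cmod (t f - g t ^ k) < e"
proof -
  have "uniformly_continuous_on (cball 0 2) (\<lambda>z::complex. z ^ k)"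
    by (intro compact_uniformly_continuous continuous_intros) auto
  then obtain d where power_modulus: "d > 0" "\<And>x y::complex. x \<in> cball 0 2 \<Longrightarrow> y \<in> cball 0 2 \<Longrightarrow>
      cmod (x - y) < d \<Longrightarrow> cmod (x ^ k - y ^ k) < e"
    using e_pos unfolding uniformly_continuous_on_def dist_norm by metis
  have "min d 1 > 0" using power_modulus(1) by simp
  then obtain f where f_approx: "\<And>t. t \<in> shilov_boundary j \<Longrightarrow> cmod (g t - t f) < min d 1"
    using check_algebra_approx[OF g_in_ball(1)] by metis
  have "cmod (t (f ^ k) - g t ^ k) < e" if t_in_boundary: "t \<in> shilov_boundary j" for t
  proof -
    have "cmod (t f) \<le> 2"
      using f_approx[OF t_in_boundary] g_in_ball(2)[OF t_in_boundary]
        norm_triangle_sub[of "t f" "g t"]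
      by (simp add: norm_minus_commute)
    then show ?thesis
      using power_modulus(2)[of "t f" "g t"] f_approx[OF t_in_boundary]
        g_in_ball(2)[OF t_in_boundary]
      by (simp add: norm_minus_commute
          character_power[OF shilov_boundary_character[OF t_in_boundary]])
  qed
  then show ?thesis by (rule that)
qed

lemma peak_point_near_impulse:
  assumes orbit: "\<And>n. p n \<in> shilov_boundary j" "\<And>n. n \<noteq> 0 \<Longrightarrow> p n \<noteq> p 0"
    and peak: "peak_point j (p 0)" and eta_pos: "\<eta> > 0"
  obtains f where "near_impulse N \<eta> (\<lambda>n. p n f)"
proof -
  obtain g where g_peak: "g \<in> check_algebra j" "g (p 0) = 1"
      and g_less: "\<And>t. t \<in> shilov_boundary j \<Longrightarrow> t \<noteq> p 0 \<Longrightarrow> cmod (g t) < 1"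
    using peak unfolding peak_point_def by blast
  have g_le: "cmod (g t) \<le> 1" if "t \<in> shilov_boundary j" for t
    using g_peak(2) g_less[OF that] by (cases "t = p 0") auto
  have "\<forall>\<^sub>F k in sequentially. \<forall>n\<in>{- int N..int N} - {0}. cmod (g (p n)) ^ k < \<eta>/2"
  proof (intro eventually_ball_finite ballI)
    fix n assume "n \<in> {- int N..int N} - {0}"
    then have "(\<lambda>k. cmod (g (p n)) ^ k) \<longlonglongrightarrow> 0"
      using g_less[OF orbit(1) orbit(2)] by (intro LIMSEQ_power_zero) simp
    then show "\<forall>\<^sub>F k in sequentially. cmod (g (p n)) ^ k < \<eta>/2"
      by (rule order_tendstoD) (use eta_pos in simp)
  qed simp
  then obtain k where k_large: "\<forall>n\<in>{- int N..int N} - {0}. cmod (g (p n)) ^ k < \<eta>/2"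
    using eventually_happens' sequentially_bot by blast
  have "min (\<eta>/2) 1 > 0" using eta_pos by simp
  then obtain f where f_approx: "\<And>t. t \<in> shilov_boundary j \<Longrightarrow> cmod (t f - g t ^ k) < min (\<eta>/2) 1"
    using check_algebra_power_approx[OF g_peak(1) g_le] by metis
  have f_le: "cmod (p n f) \<le> cmod (g (p n)) ^ k + min (\<eta>/2) 1" for n
    using f_approx[OF orbit(1), of n] norm_triangle_sub[of "p n f" "g (p n) ^ k"]
    unfolding norm_power by linarith
  have "near_impulse N \<eta> (\<lambda>n. p n f)"
    unfolding near_impulse_def
  proof (intro conjI allI impI)
    show "cmod (p 0 f - 1) \<le> \<eta>" using f_approx[OF orbit(1), of 0] g_peak(2) eta_pos by simp
    show "cmod (p n f) \<le> 2" for n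
      using f_le[of n] power_le_one[OF norm_ge_zero g_le[OF orbit(1)], of n k] by linarith
    fix n assume "n \<noteq> 0" "\<bar>n\<bar> \<le> int N"
    then have "cmod (g (p n)) ^ k < \<eta>/2" by (intro bspec[OF k_large]) auto
    then show "cmod (p n f) \<le> \<eta>" using f_le[of n] by linarith
  qed
  then show ?thesis by (rule that)
qed

section \<open>Dominated orbits and the spectrum\<close>

definition dominated_orbit :: "('a \<Rightarrow> 'a) \<Rightarrow> 'a \<Rightarrow> complex \<Rightarrow> (int \<Rightarrow> 'a \<Rightarrow> complex) \<Rightarrow> bool" where
  "dominated_orbit U w c p \<longleftrightarrow> (\<forall>n. p n \<in> shilov_boundary j) \<and> (\<forall>n. p (n + 1) = induced_map U (p n)) \<and>
     (\<forall>n. n \<noteq> 0 \<longrightarrow> p n \<noteq> p 0) \<and> (\<forall>n. p n w \<noteq> 0) \<and> (\<forall>n. cmod (int_prod (\<lambda>i. p i w / c) n) \<le> 1)"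

lemma dominated_orbitD:
  assumes "dominated_orbit U w c p"
  shows "p n \<in> shilov_boundary j" "p (n + 1) = induced_map U (p n)" "n \<noteq> 0 \<Longrightarrow> p n \<noteq> p 0"
    "p n w \<noteq> 0" "cmod (int_prod (\<lambda>i. p i w / c) n) \<le> 1"
  using assms by (simp_all add: dominated_orbit_def)

lemma dominated_orbit_near_impulse:
  assumes "dominated_orbit U w c p" "peak_point j (p 0)" "\<eta> > 0"
  obtains f where "near_impulse N \<eta> (\<lambda>n. p n f)"
  by (rule peak_point_near_impulse[of p]) (use assms dominated_orbitD[OF assms(1)] that in auto)

lemma check_resolvent_solution:
  assumes "c \<notin> check_spectrum j U w" and F_in_algebra: "F \<in> bounded_check_algebra_funs"
  shows "\<exists>G\<in>bounded_check_algebra_funs. \<forall>t\<in>shilov_boundary j.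
    t w * bounded_fun_apply G (induced_map U t) - c * bounded_fun_apply G t = bounded_fun_apply F t"
proof -
  have "check_algebra j \<subseteq> (\<lambda>g t. check_op j U w g t - c * g t) ` check_algebra j"
    using assms(1) by (auto simp: check_spectrum_def bij_betw_def)
  then obtain g where g_in_algebra: "g \<in> check_algebra j"
      and g_solves: "\<And>t. check_op j U w g t - c * g t = bounded_fun_apply F t"
    using F_in_algebra by (force simp: bounded_check_algebra_funs_def fun_eq_iff)
  obtain G where "bounded_fun_apply G = g"
    by (rule exists_bounded_fun[OF bounded_check_algebra[OF g_in_algebra]]) (rule that)
  then show ?thesis
    using g_in_algebra
    by (intro bexI[of _ G])
       (auto simp: bounded_check_algebra_funs_def check_op_def simp flip: g_solves)
qed

lemma exists_bounded_gelfand_transform: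
  obtains F where "F \<in> bounded_check_algebra_funs"
    "\<And>t. t \<in> shilov_boundary j \<Longrightarrow> bounded_fun_apply F t = t f"
proof -
  let ?f = "\<lambda>t. if t \<in> shilov_boundary j then t f else 0"
  have f_in_algebra: "?f \<in> check_algebra j" by (rule gelfand_transform_in_check_algebra)
  obtain F where "bounded_fun_apply F = ?f"
    by (rule exists_bounded_fun[OF bounded_check_algebra[OF f_in_algebra]]) (rule that)
  then show ?thesis
    using f_in_algebra by (intro that[of F]) (simp_all add: bounded_check_algebra_funs_def)
qed

lemma dominated_orbit_in_check_spectrum:
  assumes automorphism: "algebra_automorphism j U" and dominated: "dominated_orbit U w c p"
    and peak: "peak_point j (p 0)" and c_nonzero: "c \<noteq> 0"
  shows "c \<in> check_spectrum j U w"
proof (rule ccontr)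
  assume resolvent: "c \<notin> check_spectrum j U w"
  have "\<exists>F\<in>bounded_check_algebra_funs. \<forall>G\<in>bounded_check_algebra_funs. \<exists>t\<in>shilov_boundary j.
      t w * bounded_fun_apply G (induced_map U t) - c * bounded_fun_apply G t
        \<noteq> bounded_fun_apply F t"
  proof (rule weighted_composition_not_surjective[where ev = "\<lambda>t F. bounded_fun_apply F t"
        and W = "\<lambda>t. t w" and p = p])
    fix N \<eta> assume "\<eta> > (0::real)"
    then obtain f where "near_impulse N \<eta> (\<lambda>n. p n f)"
      by (rule dominated_orbit_near_impulse[OF dominated peak]) (rule that)
    moreover obtain F where "F \<in> bounded_check_algebra_funs"
        "\<And>t. t \<in> shilov_boundary j \<Longrightarrow> bounded_fun_apply F t = t f"
      by (rule exists_bounded_gelfand_transform) (rule that)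
    ultimately show
      "\<exists>F\<in>bounded_check_algebra_funs. near_impulse N \<eta> (\<lambda>n. bounded_fun_apply F (p n))"
      using dominated_orbitD(1)[OF dominated] by (intro bexI[of _ F]) simp_all
  qed (use automorphism c_nonzero dominated_orbitD[OF dominated]
      in \<open>auto simp: subspace_bounded_check_algebra_funs closed_bounded_check_algebra_funs
        bounded_linear_bounded_fun_apply norm_bounded_fun_apply_le induced_map_shilov_boundary\<close>)
  then show False
    using check_resolvent_solution[OF resolvent] by blast
qed

lemma dominated_orbit_in_alg_spectrum:
  assumes automorphism: "algebra_automorphism j U" and dominated: "dominated_orbit U w c p"
    and peak: "peak_point j (p 0)" and c_nonzero: "c \<noteq> 0"
  shows "c \<in> alg_spectrum j (\<lambda>f. w * U f)"
proof -
  have "\<exists>f\<in>UNIV. \<forall>g\<in>UNIV. \<exists>m\<in>characters j. m w * induced_map U m g - c * m g \<noteq> m f"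
  proof (rule weighted_composition_not_surjective[where ev = "\<lambda>m. m" and W = "\<lambda>m. m w" and p = p])
    fix N \<eta> assume "\<eta> > (0::real)"
    then show "\<exists>f\<in>UNIV. near_impulse N \<eta> (\<lambda>n. p n f)"
      by (rule dominated_orbit_near_impulse[OF dominated peak]) blast
  qed (use automorphism c_nonzero dominated_orbitD[OF dominated]
      in \<open>auto simp: bounded_linear_character norm_character_le induced_map_character
        shilov_boundary_character\<close>)
  then obtain f where f_not_attained: "\<And>g. \<exists>m\<in>characters j. m w * induced_map U m g - c * m g \<noteq> m f"
    by blast
  have "w * U g - cscale j c g \<noteq> f" for g
    using f_not_attained[of g]
    by (auto simp: character_diff character_mult character_cscale induced_map_def)
  then have "f \<notin> range (\<lambda>g. w * U g - cscale j c g)" by auto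
  then show ?thesis
    by (auto simp: alg_spectrum_def bij_def)
qed

end

lemma induced_map_comp: "induced_map (U \<circ> V) m = induced_map V (induced_map U m)"
  by (simp add: induced_map_def comp_assoc)

lemma induced_map_id [simp]: "induced_map id m = m"
  by (simp add: induced_map_def)

lemma funpow_induced_map: "(induced_map U ^^ n) m = induced_map (U ^^ n) m"
proof (induction n)
  case (Suc n)
  have "(induced_map U ^^ Suc n) m = induced_map U ((induced_map U ^^ n) m)" by simp
  also have "\<dots> = induced_map (U ^^ Suc n) m"
    by (simp only: Suc funpow_Suc_right induced_map_comp)
  finally show ?case .
qed (simp add: induced_map_def)

lemma induced_map_int_funpow_add:
  "bij U \<Longrightarrow> induced_map (int_funpow U (m + n)) t
      = induced_map (int_funpow U n) (induced_map (int_funpow U m) t)"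
  by (simp add: int_funpow_add induced_map_comp)

lemma aperiodic_orbit_neq:
  assumes bij_U: "bij U" and aperiodic: "\<not> periodic_point U t" and n_nonzero: "n \<noteq> 0"
  shows "induced_map (int_funpow U n) t \<noteq> t"
proof
  assume fixed: "induced_map (int_funpow U n) t = t"
  then have "induced_map (int_funpow U (- n)) t = t"
    using induced_map_int_funpow_add[OF bij_U, of n "- n" t] by simp
  with fixed have "induced_map (int_funpow U \<bar>n\<bar>) t = t"
    by (simp add: abs_if)
  moreover have "int_funpow U \<bar>n\<bar> = U ^^ nat \<bar>n\<bar>"
    by (simp add: int_funpow_def)
  ultimately have "(induced_map U ^^ nat \<bar>n\<bar>) t = t"
    by (simp add: funpow_induced_map)
  moreover have "nat \<bar>n\<bar> \<ge> 1" using n_nonzero by linarith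
  ultimately show False using aperiodic unfolding periodic_point_def by blast
qed

context algebra_with_characters
begin

lemma check_spectrum_0_weight_nonzero:
  assumes "0 \<notin> check_spectrum j U w" and t_in_boundary: "t \<in> shilov_boundary j"
  shows "t w \<noteq> 0"
proof -
  have "check_algebra j \<subseteq> check_op j U w ` check_algebra j"
    using assms(1) by (auto simp: check_spectrum_def bij_betw_def)
  then obtain g where "(\<lambda>t. if t \<in> shilov_boundary j then t 1 else 0) = check_op j U w g"
    using gelfand_transform_in_check_algebra[of j 1] by blast
  from fun_cong[OF this, of t] have "t w * g (induced_map U t) = 1"
    using t_in_boundary
    by (simp add: check_op_def character_1[OF shilov_boundary_character[OF t_in_boundary]])
  then show ?thesis by auto
qed

lemma compact_weight_cocycle:
  assumes automorphism: "algebra_automorphism j U"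
    and w_nonzero: "\<And>t. t \<in> shilov_boundary j \<Longrightarrow> t w \<noteq> 0"
  shows "compact_cocycle (shilov_boundary j) (\<lambda>n. induced_map (int_funpow U n))
    (\<lambda>n t. ln (cmod (int_prod (\<lambda>i. t (int_funpow U i w)) n)))"
proof
  have orbit_in_boundary: "induced_map (int_funpow U n) t \<in> shilov_boundary j"
    if "t \<in> shilov_boundary j" for n t
    by (rule induced_map_shilov_boundary[OF automorphism_int_funpow[OF automorphism] that])
  then have weights_nonzero: "t (int_funpow U n w) \<noteq> 0" if "t \<in> shilov_boundary j" for n t
    using w_nonzero[OF orbit_in_boundary[OF that, of n]] by (simp add: induced_map_def)
  have bij_U: "bij U" using automorphism by (simp add: algebra_automorphism_def)
  show "compact (shilov_boundary j)" "closed (shilov_boundary j)" "shilov_boundary j \<noteq> {}"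
    by (rule compact_shilov_boundary closed_shilov_boundary shilov_boundary_nonempty)+
  show "induced_map (int_funpow U n) t \<in> shilov_boundary j" if "t \<in> shilov_boundary j" for n t
    by (rule orbit_in_boundary[OF that])
  show "induced_map (int_funpow U 0) t = t" for t by simp
  show "ln (cmod (int_prod (\<lambda>i. t (int_funpow U i w)) (m + n))) =
      ln (cmod (int_prod (\<lambda>i. t (int_funpow U i w)) m)) +
      ln (cmod (int_prod (\<lambda>i. induced_map (int_funpow U m) t (int_funpow U i w)) n))"
    if t_in_boundary: "t \<in> shilov_boundary j" for t m n
  proof -
    have "int_prod (\<lambda>i. t (int_funpow U i w)) (m + n) = int_prod (\<lambda>i. t (int_funpow U i w)) m *
        int_prod (\<lambda>i. induced_map (int_funpow U m) t (int_funpow U i w)) n"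
      using int_prod_add[of "\<lambda>i. t (int_funpow U i w)" m n] weights_nonzero[OF t_in_boundary]
      by (simp add: int_funpow_add[OF bij_U] induced_map_def)
    then show ?thesis
      using weights_nonzero[OF t_in_boundary]
        weights_nonzero[OF orbit_in_boundary[OF t_in_boundary]]
          by (simp add: norm_mult ln_mult int_prod_nonzero)
  qed
  show "continuous_on (shilov_boundary j) (\<lambda>t. ln (cmod (int_prod (\<lambda>i. t (int_funpow U i w)) n)))"
    for n
  proof (intro continuous_on_ln continuous_on_norm ballI)
    show "continuous_on (shilov_boundary j) (\<lambda>t. int_prod (\<lambda>i. t (int_funpow U i w)) n)"
      unfolding int_prod_def
      by (intro continuous_on_divide continuous_on_prod continuous_on_eval)
         (simp add: prod_zero_iff weights_nonzero)
  qed (simp add: int_prod_nonzero weights_nonzero)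
qed

lemma exists_dominated_orbit:
  assumes automorphism: "algebra_automorphism j U"
    and w_nonzero: "\<And>t. t \<in> shilov_boundary j \<Longrightarrow> t w \<noteq> 0"
    and aperiodic: "\<And>t. t \<in> shilov_boundary j \<Longrightarrow> \<not> periodic_point U t"
  obtains p L where "\<And>c. cmod c = exp L \<Longrightarrow> dominated_orbit U w c p"
proof -
  interpret compact_cocycle "shilov_boundary j" "\<lambda>n. induced_map (int_funpow U n)"
      "\<lambda>n t. ln (cmod (int_prod (\<lambda>i. t (int_funpow U i w)) n))"
    by (rule compact_weight_cocycle[OF automorphism w_nonzero])
  obtain t where t_in_boundary: "t \<in> shilov_boundary j"
    and log_growth_le: "\<And>n. ln (cmod (int_prod (\<lambda>i. t (int_funpow U i w)) n)) \<le> of_int n * max_rate"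
    using exists_two_sided_maximum by metis
  have bij_U: "bij U" using automorphism by (simp add: algebra_automorphism_def)
  define p where "p n = induced_map (int_funpow U n) t" for n
  have p_add: "p (m + n) = induced_map (int_funpow U n) (p m)" for m n
    unfolding p_def by (rule induced_map_int_funpow_add[OF bij_U])
  have p_shilov: "p n \<in> shilov_boundary j" for n
    unfolding p_def by (rule flow_mem[OF t_in_boundary])
  have p_neq: "p n \<noteq> p 0" if "n \<noteq> 0" for n
    using aperiodic_orbit_neq[OF bij_U aperiodic[OF t_in_boundary] that] by (simp add: p_def)
  have weights_nonzero: "p n w \<noteq> 0" for n by (rule w_nonzero[OF p_shilov])
  have weight_eq: "t (int_funpow U n w) = p n w" for n by (simp add: p_def induced_map_def)
  show ?thesis
  proof (rule that[of max_rate p])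
    fix c assume norm_c: "cmod c = exp max_rate"
    then have "c \<noteq> 0" by auto
    have int_prod_pos: "cmod (int_prod (\<lambda>i. p i w) n) > 0" for n
      using weights_nonzero by (simp add: int_prod_nonzero)
    have "exp (ln (cmod (int_prod (\<lambda>i. p i w) n))) \<le> exp (of_int n * max_rate)" for n
      using log_growth_le[of n] by (simp only: weight_eq exp_le_cancel_iff)
    then have "cmod (int_prod (\<lambda>i. p i w) n) \<le> exp (of_int n * max_rate)" for n
      by (simp only: exp_ln[OF int_prod_pos])
    then have "cmod (int_prod (\<lambda>i. p i w / c) n) \<le> 1" for n
      using \<open>c \<noteq> 0\<close> weights_nonzero
      by (simp add: int_prod_divide_const norm_divide norm_power_int norm_c exp_power_int
          divide_le_eq mult.commute)
    moreover have "p (n + 1) = induced_map U (p n)" for n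
      using p_add[of n 1] by (simp add: int_funpow_def)
    ultimately show "dominated_orbit U w c p"
      using p_shilov p_neq weights_nonzero by (simp add: dominated_orbit_def)
  qed
qed

end

lemma semisimple_characters_nonempty:
  fixes j :: "'a::{real_normed_algebra_1,comm_ring_1,banach}"
  assumes "semisimple j"
  shows "characters j \<noteq> {}"
  using assms zero_neq_one[where 'a = 'a] unfolding semisimple_def by (metis empty_iff)

theorem theorem3:
  fixes j w :: "'a::{real_normed_algebra_1,comm_ring_1,banach}" and U :: "'a \<Rightarrow> 'a"
  assumes "complex_banach_alg j"
    and "semisimple j"
    and "algebra_automorphism j U"
    and "\<forall>n\<ge>1. U ^^ n \<noteq> id"
    and "check_spectrum j U w \<subseteq> sphere 0 1"
    and "\<forall>t\<in>shilov_boundary j. \<not> periodic_point U t"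
    and "\<forall>t\<in>shilov_boundary j. peak_point j t"
  shows "sphere (0::complex) 1 \<subseteq> alg_spectrum j (\<lambda>f. w * U f)"
proof
  interpret algebra_with_characters j
    using assms(1) semisimple_characters_nonempty[OF assms(2)] by unfold_locales
  have "t w \<noteq> 0" if "t \<in> shilov_boundary j" for t
    using assms(5) that by (intro check_spectrum_0_weight_nonzero) auto
  then obtain p L where dominated: "\<And>c. cmod c = exp L \<Longrightarrow> dominated_orbit U w c p"
    using exists_dominated_orbit[OF assms(3)] assms(6) by metis
  then have "dominated_orbit U w (of_real (exp L)) p" by simp
  moreover from this have peak: "peak_point j (p 0)"
    using assms(7) by (simp add: dominated_orbit_def)
  ultimately have "of_real (exp L) \<in> check_spectrum j U w"
    by (intro dominated_orbit_in_check_spectrum[OF assms(3)]) simp_all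
  then have "exp L = 1" using assms(5) by force
  fix c :: complex assume "c \<in> sphere 0 1"
  then have "cmod c = exp L" "c \<noteq> 0" using \<open>exp L = 1\<close> by auto
  then show "c \<in> alg_spectrum j (\<lambda>f. w * U f)"
    by (intro dominated_orbit_in_alg_spectrum[OF assms(3) dominated peak])
qed

end
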